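(* Let $\{\mathcal F,\mathcal G\}$ be a minimal Hilbert C*-system whose fixed point algebra $\mathcal A$ has center $\mathcal Z$. Then the category $\mathcal T$ of all canonical endomorphisms of $\{\mathcal F,\mathcal G\}$ is isomorphic to the subcategory $\mathcal M_{\mathcal G}$ of the category of free Hilbert $\mathcal Z$-bimodules with objects $\mathfrak H=\mathcal H\mathcal Z$, $\mathcal H$ a $\mathcal G$-invariant algebraic Hilbert space in $\mathcal F$, and arrows given by the corresponding $\mathcal G$-invariant module morphisms $\mathcal L_{\mathcal Z}(\mathfrak H_1,\mathfrak H_2;\mathcal G)$. The bijection of objects is given by $\rho_{\mathcal H}\leftrightarrow\mathfrak H=\mathcal H\mathcal Z$, which satisfies the conditions $$\rho_{\mathcal H}=(\mathrm{Ad}\,V)\circ\rho_1+(\mathrm{Ad}\,W)\circ\rho_2\;\longleftrightarrow\;\mathfrak H=V\mathfrak H_1+W\mathfrak H_2,$$ $$\rho_1\circ\rho_2\;\longleftrightarrow\;\mathfrak H_1\cdot\mathfrak H_2,$$ where the latter product is the inner tensor product of the Hilbert $\mathcal Z$-modules with respect to the *-homomorphism $\mathcal Z\to\mathcal L_{\mathcal Z}(\mathfrak H_2)$. The bijection on arrows is defined by $$\mathcal J:\mathcal L_{\mathcal Z}(\mathfrak H_1,\mathfrak H_2;\mathcal G)\to(\rho_1,\rho_2),\qquad \mathcal J(T):=\sum_{j,k}\Psi_jZ_{j,k}\Phi_k^*,$$ where $\{\Psi_j\}_j$, $\{\Phi_k\}_k$ are orthonormal bases of $\mathfrak H_2$,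 $\mathfrak H_1$, respectively, and $(Z_{j,k})_{j,k}$ is the matrix of the right $\mathcal Z$-linear operator $T$ from $\mathfrak H_1$ to $\mathfrak H_2$ which intertwines the $\mathcal G$-action.
   Context: C*-algebras are unital. An algebraic Hilbert space in $\mathcal F$ is a finite-dimensional subspace $\mathcal H\subset\mathcal F$ with $A^*B\in\mathbb C\mathbf 1$ for $A,B\in\mathcal H$, scalar product $\langle A,B\rangle\mathbf 1=A^*B$, always assumed to have support $\sum_j\Phi_j\Phi_j^*=\mathbf 1$ ($\{\Phi_j\}$ an orthonormal basis). For a compact group $\mathcal G$ acting on $\mathcal F$ by a pointwise norm-continuous homomorphism $\alpha:\mathcal G\to\mathrm{Aut}\,\mathcal F$ and $D\in\widehat{\mathcal G}$ (classes of irreducible unitary representations) put $\Pi_D(F)=\int_{\mathcal G}\overline{\chi_D(g)}\,\alpha_g(F)\,dg$, $\chi_D(g)=\dim D\cdot\mathrm{Tr}\,\pi(g)$, $\pi\in D$. The system is a Hilbert C*-system if for each $D$ there is an $\alpha_{\mathcal G}$-invariant algebraic Hilbert space $\mathcal H_D\subset\Pi_D\mathcal F$ carrying a representation of class $D$. One identifies $\mathcal G$ with $\alpha_{\mathcal G}$ and writes $\{\mathcal F,\mathcal G\}$; $\mathcal A$ is the fixed point algebra, $\mathcal Z=\mathcal A'\cap\mathcal A$. Minimal: $\mathcal A'\cap\mathcal F=\mathcal Z$. Canonical endomorphisms: $\rho_{\mathcal H}(A)=\sum_j\Phi_jA\Phi_j^*$, $A\in\mathcal A$, for $\mathcal G$-invariant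 algebraic Hilbert spaces $\mathcal H\subset\mathcal F$. $\mathcal T$ has these as objects and arrows $(\sigma,\tau)=\{X\in\mathcal A:X\sigma(A)=\tau(A)X\ \forall A\in\mathcal A\}$; tensor product: composition of objects, $X\times Y=X\sigma(Y)$ for $X\in(\sigma,\sigma')$, $Y\in(\tau,\tau')$. For a $\mathcal G$-invariant algebraic Hilbert space $\mathcal H$, the space $\mathfrak H=\mathcal H\mathcal Z\subset\mathcal F$ is a $\mathcal G$-invariant free right Hilbert $\mathcal Z$-module with inner product $\langle H_1,H_2\rangle=H_1^*H_2\in\mathcal Z$, and left multiplication gives a *-homomorphism $\mathcal Z\to\mathcal L_{\mathcal Z}(\mathfrak H)$ into the right $\mathcal Z$-linear operators, making it a $\mathcal Z$-bimodule. $\mathcal L_{\mathcal Z}(\mathfrak H_1,\mathfrak H_2;\mathcal G)$ denotes the right $\mathcal Z$-linear maps $\mathfrak H_1\to\mathfrak H_2$ that intertwine the $\mathcal G$-actions. In the first condition, $V,W\in\mathcal A$ are isometries with $VV^*+WW^*=\mathbf 1$, $(\mathrm{Ad}\,V)(A)=VAV^*$, and $\rho_i\leftrightarrow\mathfrak H_i$, $i=1,2$. *)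

theory Defs
  imports
    "HOL-Analysis.Bochner_Integration"
    "HOL-Algebra.Group"
    "Jordan_Normal_Form.Schur_Decomposition"
begin

section \<open>Unital C*-algebras\<close>

class cstar_algebra = banach + real_normed_algebra_1 +
  fixes cscale :: "complex \<Rightarrow> 'a \<Rightarrow> 'a"  (infixr \<open>*\<^sub>C\<close> 75)
    and adj :: "'a \<Rightarrow> 'a"  (\<open>_\<^sup>\<star>\<close> [1000] 999)
  assumes cscale_add_right: "c *\<^sub>C (x + y) = c *\<^sub>C x + c *\<^sub>C y"
    and cscale_add_left: "(c + d) *\<^sub>C x = c *\<^sub>C x + d *\<^sub>C x"
    and cscale_cscale: "c *\<^sub>C d *\<^sub>C x = (c * d) *\<^sub>C x"
    and cscale_one: "1 *\<^sub>C x = x"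
    and scaleR_cscale: "r *\<^sub>R x = complex_of_real r *\<^sub>C x"
    and norm_cscale: "norm (c *\<^sub>C x) = cmod c * norm x"
    and mult_cscale_left: "(c *\<^sub>C x) * y = c *\<^sub>C (x * y)"
    and mult_cscale_right: "x * (c *\<^sub>C y) = c *\<^sub>C (x * y)"
    and adj_adj: "(x\<^sup>\<star>)\<^sup>\<star> = x"
    and adj_add: "(x + y)\<^sup>\<star> = x\<^sup>\<star> + y\<^sup>\<star>"
    and adj_cscale: "(c *\<^sub>C x)\<^sup>\<star> = cnj c *\<^sub>C x\<^sup>\<star>"
    and adj_mult: "(x * y)\<^sup>\<star> = y\<^sup>\<star> * x\<^sup>\<star>"
    and cstar_identity: "norm (x\<^sup>\<star> * x) = (norm x)\<^sup>2"

global_interpretation cvec: vector_space "cscale :: complex \<Rightarrow> 'a \<Rightarrow> 'a::cstar_algebra"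
  by unfold_locales (simp_all add: cscale_add_right cscale_add_left cscale_cscale cscale_one)

definition star_automorphism :: "('a::cstar_algebra \<Rightarrow> 'a) \<Rightarrow> bool" where
  "star_automorphism f \<longleftrightarrow> bij f \<and>
     (\<forall>x y. f (x + y) = f x + f y) \<and> (\<forall>c x. f (c *\<^sub>C x) = c *\<^sub>C f x) \<and>
     (\<forall>x y. f (x * y) = f x * f y) \<and> (\<forall>x. f (x\<^sup>\<star>) = (f x)\<^sup>\<star>)"

definition commutant :: "'a::cstar_algebra set \<Rightarrow> 'a set" where
  "commutant S = {x. \<forall>a\<in>S. x * a = a * x}"

definition span_prod :: "'a::cstar_algebra set \<Rightarrow> 'a set \<Rightarrow> 'a set" where
  "span_prod S T = cvec.span {x * y |x y. x \<in> S \<and> y \<in> T}"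


section \<open>Compact groups: Haar measure, integration, unitary dual\<close>

text \<open>
  Groups are written additively because \<^class>\<open>topological_group_add\<close> is the library's class of
  topological groups; they are not assumed to be commutative. Compactness is a separate assumption.
\<close>

definition normalized_haar ::
    "'g::{topological_group_add, t2_space} measure \<Rightarrow> bool" where
  "normalized_haar \<mu> \<longleftrightarrow> sets \<mu> = sets borel \<and> emeasure \<mu> (space \<mu>) = 1 \<and>
     (\<forall>g. \<forall>B\<in>sets borel. emeasure \<mu> ((+) g ` B) = emeasure \<mu> B) \<and>
     (\<forall>B\<in>sets borel. emeasure \<mu> B = (INF U\<in>{U. open U \<and> B \<subseteq> U}. emeasure \<mu> U))"

definition haar_measure :: "'g::{topological_group_add, t2_space} measure" where
  "haar_measure = (THE \<mu>. normalized_haar \<mu>)"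

text \<open>
  The Bochner integral. The library's \<^const>\<open>has_bochner_integral\<close> is defined by the same
  approximation, but its type restricts it to separable spaces.
\<close>

definition bochner_integral_is ::
    "'g::{topological_group_add, t2_space} measure \<Rightarrow> ('g \<Rightarrow> 'a::banach) \<Rightarrow> 'a \<Rightarrow> bool" where
  "bochner_integral_is \<mu> f I \<longleftrightarrow> f \<in> borel_measurable \<mu> \<and>
     (\<exists>s. (\<forall>i. Bochner_Integration.simple_bochner_integrable \<mu> (s i)) \<and>
          (\<lambda>i. \<integral>\<^sup>+x. ennreal (norm (f x - s i x)) \<partial>\<mu>) \<longlonglongrightarrow> 0 \<and>
          (\<lambda>i. Bochner_Integration.simple_bochner_integral \<mu> (s i)) \<longlonglongrightarrow> I)"

definition haar_integral ::
    "('g::{topological_group_add, t2_space} \<Rightarrow> 'a::banach) \<Rightarrow> 'a" where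
  "haar_integral f = (THE I. bochner_integral_is haar_measure f I)"

definition unitary_rep ::
    "nat \<Rightarrow> ('g::{topological_group_add, t2_space} \<Rightarrow> complex mat) \<Rightarrow> bool" where
  "unitary_rep n \<pi> \<longleftrightarrow>
     (\<forall>g. \<pi> g \<in> carrier_mat n n \<and> mat_adjoint (\<pi> g) * \<pi> g = 1\<^sub>m n) \<and>
     (\<forall>g h. \<pi> (g + h) = \<pi> g * \<pi> h) \<and>
     (\<forall>i<n. \<forall>j<n. continuous_on UNIV (\<lambda>g. \<pi> g $$ (i, j)))"

definition irreducible_rep ::
    "nat \<Rightarrow> ('g::{topological_group_add, t2_space} \<Rightarrow> complex mat) \<Rightarrow> bool" where
  "irreducible_rep n \<pi> \<longleftrightarrow> 0 < n \<and>
     (\<forall>W. W \<subseteq> carrier_vec n \<and> 0\<^sub>v n \<in> W \<and> (\<forall>v\<in>W. \<forall>w\<in>W. v + w \<in> W) \<and>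
          (\<forall>c. \<forall>v\<in>W. c \<cdot>\<^sub>v v \<in> W) \<and> (\<forall>g. \<forall>v\<in>W. \<pi> g *\<^sub>v v \<in> W)
          \<longrightarrow> W = {0\<^sub>v n} \<or> W = carrier_vec n)"

definition irreps :: "('g::{topological_group_add, t2_space} \<Rightarrow> complex mat) set" where
  "irreps = {\<pi>. \<exists>n. unitary_rep n \<pi> \<and> irreducible_rep n \<pi>}"

definition rep_dim :: "('g::{topological_group_add, t2_space} \<Rightarrow> complex mat) \<Rightarrow> nat" where
  "rep_dim \<pi> = dim_row (\<pi> 0)"

definition unitarily_equivalent ::
    "('g::{topological_group_add, t2_space} \<Rightarrow> complex mat) \<Rightarrow> ('g \<Rightarrow> complex mat) \<Rightarrow> bool" where
  "unitarily_equivalent \<pi> \<sigma> \<longleftrightarrow> rep_dim \<pi> = rep_dim \<sigma> \<and>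
     (\<exists>U \<in> carrier_mat (rep_dim \<pi>) (rep_dim \<pi>).
        mat_adjoint U * U = 1\<^sub>m (rep_dim \<pi>) \<and> (\<forall>g. U * \<pi> g = \<sigma> g * U))"

definition unitary_dual :: "('g::{topological_group_add, t2_space} \<Rightarrow> complex mat) set set" where
  "unitary_dual = irreps // {(\<pi>, \<sigma>). \<pi> \<in> irreps \<and> \<sigma> \<in> irreps \<and> unitarily_equivalent \<pi> \<sigma>}"

text \<open>The character carries the factor \<open>dim D\<close>; it does not depend on the representative.\<close>

definition dual_char ::
    "('g::{topological_group_add, t2_space} \<Rightarrow> complex mat) set \<Rightarrow> 'g \<Rightarrow> complex" where
  "dual_char D g = (let \<pi> = (SOME \<pi>. \<pi> \<in> D)
     in of_nat (rep_dim \<pi>) * (\<Sum>i<rep_dim \<pi>. \<pi> g $$ (i, i)))"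


section \<open>Hilbert C*-systems\<close>

definition orthonormal_basis :: "'a::cstar_algebra set \<Rightarrow> nat \<Rightarrow> (nat \<Rightarrow> 'a) \<Rightarrow> bool" where
  "orthonormal_basis H n \<Phi> \<longleftrightarrow> H = cvec.span (\<Phi> ` {..<n}) \<and>
     (\<forall>i<n. \<forall>j<n. (\<Phi> i)\<^sup>\<star> * \<Phi> j = (if i = j then 1 else 0))"

definition algebraic_hilbert_space :: "'a::cstar_algebra set \<Rightarrow> bool" where
  "algebraic_hilbert_space H \<longleftrightarrow> cvec.subspace H \<and> (\<exists>B. finite B \<and> cvec.span B = H) \<and>
     (\<forall>x\<in>H. \<forall>y\<in>H. \<exists>c. x\<^sup>\<star> * y = c *\<^sub>C 1) \<and>
     (\<exists>n \<Phi>. orthonormal_basis H n \<Phi> \<and> (\<Sum>j<n. \<Phi> j * (\<Phi> j)\<^sup>\<star>) = 1)"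

definition cstar_dynamical_system ::
    "('g::{topological_group_add, t2_space} \<Rightarrow> 'a::cstar_algebra \<Rightarrow> 'a) \<Rightarrow> bool" where
  "cstar_dynamical_system \<alpha> \<longleftrightarrow> compact (UNIV :: 'g set) \<and>
     (\<forall>g. star_automorphism (\<alpha> g)) \<and> (\<forall>g h. \<alpha> (g + h) = \<alpha> g \<circ> \<alpha> h) \<and>
     (\<forall>x. continuous_on UNIV (\<lambda>g. \<alpha> g x))"

definition invariant ::
    "('g::{topological_group_add, t2_space} \<Rightarrow> 'a::cstar_algebra \<Rightarrow> 'a) \<Rightarrow> 'a set \<Rightarrow> bool" where
  "invariant \<alpha> H \<longleftrightarrow> (\<forall>g. \<alpha> g ` H \<subseteq> H)"

definition inv_ahs ::
    "('g::{topological_group_add, t2_space} \<Rightarrow> 'a::cstar_algebra \<Rightarrow> 'a) \<Rightarrow> 'a set \<Rightarrow> bool" where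
  "inv_ahs \<alpha> H \<longleftrightarrow> algebraic_hilbert_space H \<and> invariant \<alpha> H"

definition spectral_projection ::
    "('g::{topological_group_add, t2_space} \<Rightarrow> 'a::cstar_algebra \<Rightarrow> 'a)
      \<Rightarrow> ('g \<Rightarrow> complex mat) set \<Rightarrow> 'a \<Rightarrow> 'a" where
  "spectral_projection \<alpha> D x = haar_integral (\<lambda>g. cnj (dual_char D g) *\<^sub>C \<alpha> g x)"

text \<open>
  The action on \<open>H\<close> is unitarily equivalent to \<open>\<pi>\<close>. The scalar product of \<open>H\<close> is conjugate linear in
  its first argument, whereas \<^term>\<open>v \<bullet>c w\<close> is conjugate linear in \<open>w\<close>.
\<close>

definition carries_rep ::
    "('g::{topological_group_add, t2_space} \<Rightarrow> 'a::cstar_algebra \<Rightarrow> 'a)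
      \<Rightarrow> 'a set \<Rightarrow> ('g \<Rightarrow> complex mat) \<Rightarrow> bool" where
  "carries_rep \<alpha> H \<pi> \<longleftrightarrow> (let V = carrier_vec (rep_dim \<pi>) in
     \<exists>U. bij_betw U V H \<and>
       (\<forall>v\<in>V. \<forall>w\<in>V. U (v + w) = U v + U w) \<and> (\<forall>c. \<forall>v\<in>V. U (c \<cdot>\<^sub>v v) = c *\<^sub>C U v) \<and>
       (\<forall>v\<in>V. \<forall>w\<in>V. (U v)\<^sup>\<star> * U w = (w \<bullet>c v) *\<^sub>C 1) \<and>
       (\<forall>g. \<forall>v\<in>V. \<alpha> g (U v) = U (\<pi> g *\<^sub>v v)))"

definition hilbert_cstar_system ::
    "('g::{topological_group_add, t2_space} \<Rightarrow> 'a::cstar_algebra \<Rightarrow> 'a) \<Rightarrow> bool" where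
  "hilbert_cstar_system \<alpha> \<longleftrightarrow> cstar_dynamical_system \<alpha> \<and>
     (\<forall>D\<in>unitary_dual. \<exists>H. inv_ahs \<alpha> H \<and> H \<subseteq> range (spectral_projection \<alpha> D) \<and>
        (\<exists>\<pi>\<in>D. carries_rep \<alpha> H \<pi>))"

definition fixed_algebra ::
    "('g::{topological_group_add, t2_space} \<Rightarrow> 'a::cstar_algebra \<Rightarrow> 'a) \<Rightarrow> 'a set" where
  "fixed_algebra \<alpha> = {x. \<forall>g. \<alpha> g x = x}"

definition fixed_center ::
    "('g::{topological_group_add, t2_space} \<Rightarrow> 'a::cstar_algebra \<Rightarrow> 'a) \<Rightarrow> 'a set" where
  "fixed_center \<alpha> = commutant (fixed_algebra \<alpha>) \<inter> fixed_algebra \<alpha>"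

definition minimal_hilbert_cstar_system ::
    "('g::{topological_group_add, t2_space} \<Rightarrow> 'a::cstar_algebra \<Rightarrow> 'a) \<Rightarrow> bool" where
  "minimal_hilbert_cstar_system \<alpha> \<longleftrightarrow>
     hilbert_cstar_system \<alpha> \<and> commutant (fixed_algebra \<alpha>) = fixed_center \<alpha>"


section \<open>Categories\<close>

text \<open>
  Arrows are given by hom-sets; these need not be disjoint, so identities, composition and the arrow
  part of a functor take the objects as arguments. \<open>Comp C a b c g f\<close> is \<open>g \<circ> f\<close> for
  \<open>f : a \<rightarrow> b\<close> and \<open>g : b \<rightarrow> c\<close>.
\<close>

record ('o, 'm) cat =
  Obj :: "'o set"
  Hom :: "'o \<Rightarrow> 'o \<Rightarrow> 'm set"
  Ident :: "'o \<Rightarrow> 'm"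
  Comp :: "'o \<Rightarrow> 'o \<Rightarrow> 'o \<Rightarrow> 'm \<Rightarrow> 'm \<Rightarrow> 'm"

definition category :: "('o, 'm) cat \<Rightarrow> bool" where
  "category C \<longleftrightarrow>
     (\<forall>a\<in>Obj C. Ident C a \<in> Hom C a a) \<and>
     (\<forall>a\<in>Obj C. \<forall>b\<in>Obj C. \<forall>c\<in>Obj C. \<forall>f\<in>Hom C a b. \<forall>g\<in>Hom C b c.
        Comp C a b c g f \<in> Hom C a c) \<and>
     (\<forall>a\<in>Obj C. \<forall>b\<in>Obj C. \<forall>f\<in>Hom C a b.
        Comp C a a b f (Ident C a) = f \<and> Comp C a b b (Ident C b) f = f) \<and>
     (\<forall>a\<in>Obj C. \<forall>b\<in>Obj C. \<forall>c\<in>Obj C. \<forall>d\<in>Obj C.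
        \<forall>f\<in>Hom C a b. \<forall>g\<in>Hom C b c. \<forall>h\<in>Hom C c d.
        Comp C a b d (Comp C b c d h g) f = Comp C a c d h (Comp C a b c g f))"

definition subcategory :: "('o, 'm) cat \<Rightarrow> ('o, 'm) cat \<Rightarrow> bool" where
  "subcategory C D \<longleftrightarrow> category C \<and> category D \<and> Obj C \<subseteq> Obj D \<and>
     (\<forall>a\<in>Obj C. \<forall>b\<in>Obj C. Hom C a b \<subseteq> Hom D a b) \<and>
     (\<forall>a\<in>Obj C. Ident C a = Ident D a) \<and>
     (\<forall>a\<in>Obj C. \<forall>b\<in>Obj C. \<forall>c\<in>Obj C. \<forall>f\<in>Hom C a b. \<forall>g\<in>Hom C b c.
        Comp C a b c g f = Comp D a b c g f)"

definition cat_functor ::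
    "('o, 'm) cat \<Rightarrow> ('p, 'n) cat \<Rightarrow> ('o \<Rightarrow> 'p) \<Rightarrow> ('o \<Rightarrow> 'o \<Rightarrow> 'm \<Rightarrow> 'n) \<Rightarrow> bool" where
  "cat_functor C D F A \<longleftrightarrow>
     (\<forall>a\<in>Obj C. F a \<in> Obj D) \<and>
     (\<forall>a\<in>Obj C. \<forall>b\<in>Obj C. \<forall>f\<in>Hom C a b. A a b f \<in> Hom D (F a) (F b)) \<and>
     (\<forall>a\<in>Obj C. A a a (Ident C a) = Ident D (F a)) \<and>
     (\<forall>a\<in>Obj C. \<forall>b\<in>Obj C. \<forall>c\<in>Obj C. \<forall>f\<in>Hom C a b. \<forall>g\<in>Hom C b c.
        A a c (Comp C a b c g f) = Comp D (F a) (F b) (F c) (A b c g) (A a b f))"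

definition cat_isomorphism ::
    "('o, 'm) cat \<Rightarrow> ('p, 'n) cat \<Rightarrow> ('o \<Rightarrow> 'p) \<Rightarrow> ('o \<Rightarrow> 'o \<Rightarrow> 'm \<Rightarrow> 'n) \<Rightarrow> bool" where
  "cat_isomorphism C D F A \<longleftrightarrow> category C \<and> category D \<and> cat_functor C D F A \<and>
     bij_betw F (Obj C) (Obj D) \<and>
     (\<forall>a\<in>Obj C. \<forall>b\<in>Obj C. bij_betw (A a b) (Hom C a b) (Hom D (F a) (F b)))"


section \<open>Hilbert modules and bimodules over a C*-subalgebra\<close>

text \<open>
  \<open>hsmul x z\<close> is the right action \<open>x \<cdot> z\<close>, \<open>hleft z x\<close> the left action \<open>z \<cdot> x\<close>. The coefficient
  algebra \<open>Z\<close> is a unital C*-subalgebra of the algebra \<^typ>\<open>'a\<close>; the complex scalars act through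
  multiples of \<open>1 \<in> Z\<close>.
\<close>

record ('a, 'm) hmod =
  hcarrier :: "'m set"
  hadd :: "'m \<Rightarrow> 'm \<Rightarrow> 'm"
  hzero :: 'm
  hsmul :: "'m \<Rightarrow> 'a \<Rightarrow> 'm"
  hinner :: "'m \<Rightarrow> 'm \<Rightarrow> 'a"
  hleft :: "'a \<Rightarrow> 'm \<Rightarrow> 'm"

definition hgroup :: "('a, 'm) hmod \<Rightarrow> 'm monoid" where
  "hgroup M = \<lparr>carrier = hcarrier M, mult = hadd M, one = hzero M\<rparr>"

definition hminus :: "('a::cstar_algebra, 'm) hmod \<Rightarrow> 'm \<Rightarrow> 'm \<Rightarrow> 'm" where
  "hminus M x y = hadd M x (hsmul M y (- 1))"

definition hnorm :: "('a::cstar_algebra, 'm) hmod \<Rightarrow> 'm \<Rightarrow> real" where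
  "hnorm M x = sqrt (norm (hinner M x x))"

definition right_module :: "'a::cstar_algebra set \<Rightarrow> ('a, 'm) hmod \<Rightarrow> bool" where
  "right_module Z M \<longleftrightarrow> comm_group (hgroup M) \<and>
     (\<forall>x\<in>hcarrier M. \<forall>z\<in>Z. hsmul M x z \<in> hcarrier M) \<and>
     (\<forall>x\<in>hcarrier M. \<forall>y\<in>hcarrier M. \<forall>z\<in>Z.
        hsmul M (hadd M x y) z = hadd M (hsmul M x z) (hsmul M y z)) \<and>
     (\<forall>x\<in>hcarrier M. \<forall>z\<in>Z. \<forall>w\<in>Z.
        hsmul M x (z + w) = hadd M (hsmul M x z) (hsmul M x w) \<and>
        hsmul M x (z * w) = hsmul M (hsmul M x z) w) \<and>
     (\<forall>x\<in>hcarrier M. hsmul M x 1 = x)"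

text \<open>
  Positivity of \<open>\<langle>x, x\<rangle>\<close> is positivity in the ambient C*-algebra, which for elements of a C*-subalgebra
  is the same as positivity in the subalgebra.
\<close>

definition hilbert_module :: "'a::cstar_algebra set \<Rightarrow> ('a, 'm) hmod \<Rightarrow> bool" where
  "hilbert_module Z M \<longleftrightarrow> right_module Z M \<and>
     (\<forall>x\<in>hcarrier M. \<forall>y\<in>hcarrier M. hinner M x y \<in> Z \<and> hinner M y x = (hinner M x y)\<^sup>\<star>) \<and>
     (\<forall>x\<in>hcarrier M. \<forall>y\<in>hcarrier M. \<forall>y'\<in>hcarrier M.
        hinner M x (hadd M y y') = hinner M x y + hinner M x y') \<and>
     (\<forall>x\<in>hcarrier M. \<forall>y\<in>hcarrier M. \<forall>z\<in>Z. hinner M x (hsmul M y z) = hinner M x y * z) \<and>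
     (\<forall>x\<in>hcarrier M. \<exists>a. hinner M x x = a\<^sup>\<star> * a) \<and>
     (\<forall>x\<in>hcarrier M. hinner M x x = 0 \<longrightarrow> x = hzero M) \<and>
     (\<forall>X. (\<forall>k::nat. X k \<in> hcarrier M) \<and>
          (\<forall>e>0. \<exists>K. \<forall>k\<ge>K. \<forall>l\<ge>K. hnorm M (hminus M (X k) (X l)) < e) \<longrightarrow>
          (\<exists>x\<in>hcarrier M. (\<lambda>k. hnorm M (hminus M (X k) x)) \<longlonglongrightarrow> 0))"

definition right_linear_maps ::
    "'a::cstar_algebra set \<Rightarrow> ('a, 'm) hmod \<Rightarrow> ('a, 'n) hmod \<Rightarrow> ('m \<Rightarrow> 'n) set" where
  "right_linear_maps Z M N = {T \<in> hcarrier M \<rightarrow>\<^sub>E hcarrier N.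
     (\<forall>x\<in>hcarrier M. \<forall>y\<in>hcarrier M. T (hadd M x y) = hadd N (T x) (T y)) \<and>
     (\<forall>x\<in>hcarrier M. \<forall>z\<in>Z. T (hsmul M x z) = hsmul N (T x) z)}"

text \<open>The left action is a unital *-homomorphism from \<open>Z\<close> into the right linear operators on \<open>M\<close>.\<close>

definition hilbert_bimodule :: "'a::cstar_algebra set \<Rightarrow> ('a, 'm) hmod \<Rightarrow> bool" where
  "hilbert_bimodule Z M \<longleftrightarrow> hilbert_module Z M \<and>
     (\<forall>z\<in>Z. restrict (hleft M z) (hcarrier M) \<in> right_linear_maps Z M M) \<and>
     (\<forall>z\<in>Z. \<forall>w\<in>Z. \<forall>x\<in>hcarrier M.
        hleft M (z + w) x = hadd M (hleft M z x) (hleft M w x) \<and>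
        hleft M (z * w) x = hleft M z (hleft M w x)) \<and>
     (\<forall>z\<in>Z. \<forall>c. \<forall>x\<in>hcarrier M. hleft M (c *\<^sub>C z) x = hsmul M (hleft M z x) (c *\<^sub>C 1)) \<and>
     (\<forall>x\<in>hcarrier M. hleft M 1 x = x) \<and>
     (\<forall>z\<in>Z. \<forall>x\<in>hcarrier M. \<forall>y\<in>hcarrier M.
        hinner M (hleft M z x) y = hinner M x (hleft M (z\<^sup>\<star>) y))"

definition module_onb ::
    "'a::cstar_algebra set \<Rightarrow> ('a, 'm) hmod \<Rightarrow> nat \<Rightarrow> (nat \<Rightarrow> 'm) \<Rightarrow> bool" where
  "module_onb Z M n e \<longleftrightarrow> (\<forall>i<n. e i \<in> hcarrier M) \<and>
     (\<forall>i<n. \<forall>j<n. hinner M (e i) (e j) = (if i = j then 1 else 0)) \<and>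
     (\<forall>x\<in>hcarrier M. \<exists>c. (\<forall>i<n. c i \<in> Z) \<and>
        x = finprod (hgroup M) (\<lambda>i. hsmul M (e i) (c i)) {..<n})"

definition free_hilbert_bimodule :: "'a::cstar_algebra set \<Rightarrow> ('a, 'm) hmod \<Rightarrow> bool" where
  "free_hilbert_bimodule Z M \<longleftrightarrow> hilbert_bimodule Z M \<and> (\<exists>n e. module_onb Z M n e)"

definition free_bimodule_cat ::
    "'a::cstar_algebra set \<Rightarrow> (('a, 'm) hmod, 'm \<Rightarrow> 'm) cat" where
  "free_bimodule_cat Z =
     \<lparr>Obj = {M. free_hilbert_bimodule Z M},
      Hom = right_linear_maps Z,
      Ident = (\<lambda>M. \<lambda>x\<in>hcarrier M. x),
      Comp = (\<lambda>M N P S T. compose (hcarrier M) S T)\<rparr>"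


subsection \<open>Inner tensor product\<close>

text \<open>
  The inner tensor product of \<open>E\<close> and \<open>F\<close> with respect to the left action of \<open>Z\<close> on \<open>F\<close>: a list
  \<open>[(x\<^sub>1, y\<^sub>1), \<dots>, (x\<^sub>n, y\<^sub>n)]\<close> stands for the element \<open>x\<^sub>1 \<otimes> y\<^sub>1 + \<dots> + x\<^sub>n \<otimes> y\<^sub>n\<close> of the algebraic
  tensor product. One divides by the null vectors of the form determined by
  \<open>\<langle>x \<otimes> y, x' \<otimes> y'\<rangle> = \<langle>y, \<langle>x, x'\<rangle> \<cdot> y'\<rangle>\<close> and completes. The tensor relations themselves hold modulo
  null vectors, so it is not necessary to divide by them beforehand.
\<close>

definition tensor_form ::
    "('a::cstar_algebra, 'm) hmod \<Rightarrow> ('a, 'n) hmod \<Rightarrow> ('m \<times> 'n) list \<Rightarrow> ('m \<times> 'n) list \<Rightarrow> 'a" where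
  "tensor_form E F u v =
     (\<Sum>(x, y)\<leftarrow>u. \<Sum>(x', y')\<leftarrow>v. hinner F y (hleft F (hinner E x x') y'))"

definition tensor_neg ::
    "('a::cstar_algebra, 'm) hmod \<Rightarrow> ('a, 'n) hmod \<Rightarrow> ('m \<times> 'n) list \<Rightarrow> ('m \<times> 'n) list" where
  "tensor_neg E F u = map (\<lambda>(x, y). (x, hsmul F y (- 1))) u"

definition tensor_class ::
    "('a::cstar_algebra, 'm) hmod \<Rightarrow> ('a, 'n) hmod \<Rightarrow> ('m \<times> 'n) list \<Rightarrow> ('m \<times> 'n) list set" where
  "tensor_class E F u = {v \<in> lists (hcarrier E \<times> hcarrier F).
     tensor_form E F (u @ tensor_neg E F v) (u @ tensor_neg E F v) = 0}"

definition pre_tensor ::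
    "('a::cstar_algebra, 'm) hmod \<Rightarrow> ('a, 'n) hmod \<Rightarrow> ('a, ('m \<times> 'n) list set) hmod" where
  "pre_tensor E F = (let rep = (\<lambda>A. SOME u. u \<in> A) in
     \<lparr>hcarrier = tensor_class E F ` lists (hcarrier E \<times> hcarrier F),
      hadd = (\<lambda>A B. tensor_class E F (rep A @ rep B)),
      hzero = tensor_class E F [],
      hsmul = (\<lambda>A z. tensor_class E F (map (\<lambda>(x, y). (x, hsmul F y z)) (rep A))),
      hinner = (\<lambda>A B. tensor_form E F (rep A) (rep B)),
      hleft = (\<lambda>z A. tensor_class E F (map (\<lambda>(x, y). (hleft E z x, y)) (rep A)))\<rparr>)"

definition hmod_completion ::
    "'a::cstar_algebra set \<Rightarrow> ('a, 'm) hmod \<Rightarrow> ('a, 'n) hmod \<Rightarrow> ('m \<Rightarrow> 'n) \<Rightarrow> bool" where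
  "hmod_completion Z P M U \<longleftrightarrow> hilbert_bimodule Z M \<and>
     (\<forall>a\<in>hcarrier P. U a \<in> hcarrier M) \<and>
     (\<forall>a\<in>hcarrier P. \<forall>b\<in>hcarrier P.
        U (hadd P a b) = hadd M (U a) (U b) \<and> hinner M (U a) (U b) = hinner P a b) \<and>
     (\<forall>a\<in>hcarrier P. \<forall>z\<in>Z.
        U (hsmul P a z) = hsmul M (U a) z \<and> U (hleft P z a) = hleft M z (U a)) \<and>
     (\<forall>x\<in>hcarrier M. \<forall>e>0. \<exists>a\<in>hcarrier P. hnorm M (hminus M x (U a)) < e)"

text \<open>\<open>M\<close> is the inner tensor product of \<open>E\<close> and \<open>F\<close>, with elementary tensors \<open>x \<otimes> y = t x y\<close>.\<close>

definition inner_tensor_product ::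
    "'a::cstar_algebra set \<Rightarrow> ('a, 'm) hmod \<Rightarrow> ('a, 'n) hmod \<Rightarrow> ('a, 'k) hmod
      \<Rightarrow> ('m \<Rightarrow> 'n \<Rightarrow> 'k) \<Rightarrow> bool" where
  "inner_tensor_product Z E F M t \<longleftrightarrow> (\<exists>U. hmod_completion Z (pre_tensor E F) M U \<and>
     (\<forall>x\<in>hcarrier E. \<forall>y\<in>hcarrier F. U (tensor_class E F [(x, y)]) = t x y))"


section \<open>Canonical endomorphisms and the associated modules\<close>

text \<open>
  Endomorphisms of the fixed point algebra are functions restricted to it, so that equality of objects
  is equality on the fixed point algebra. The formula does not depend on the orthonormal basis.
\<close>

definition canonical_endo ::
    "('g::{topological_group_add, t2_space} \<Rightarrow> 'a::cstar_algebra \<Rightarrow> 'a) \<Rightarrow> 'a set \<Rightarrow> 'a \<Rightarrow> 'a" where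
  "canonical_endo \<alpha> H = (\<lambda>a\<in>fixed_algebra \<alpha>.
     let (n, \<Phi>) = (SOME (n, \<Phi>). orthonormal_basis H n \<Phi>) in \<Sum>j<n. \<Phi> j * a * (\<Phi> j)\<^sup>\<star>)"

definition endo_cat ::
    "('g::{topological_group_add, t2_space} \<Rightarrow> 'a::cstar_algebra \<Rightarrow> 'a) \<Rightarrow> ('a \<Rightarrow> 'a, 'a) cat" where
  "endo_cat \<alpha> =
     \<lparr>Obj = canonical_endo \<alpha> ` {H. inv_ahs \<alpha> H},
      Hom = (\<lambda>\<sigma> \<tau>. {X \<in> fixed_algebra \<alpha>. \<forall>a\<in>fixed_algebra \<alpha>. X * \<sigma> a = \<tau> a * X}),
      Ident = (\<lambda>\<sigma>. 1),
      Comp = (\<lambda>\<rho> \<sigma> \<tau> Y X. Y * X)\<rparr>"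

definition concrete_module :: "'a::cstar_algebra set \<Rightarrow> ('a, 'a) hmod" where
  "concrete_module S = \<lparr>hcarrier = S, hadd = (+), hzero = 0, hsmul = (*),
     hinner = (\<lambda>x y. x\<^sup>\<star> * y), hleft = (*)\<rparr>"

definition assoc_module ::
    "('g::{topological_group_add, t2_space} \<Rightarrow> 'a::cstar_algebra \<Rightarrow> 'a) \<Rightarrow> 'a set \<Rightarrow> ('a, 'a) hmod" where
  "assoc_module \<alpha> H = concrete_module (span_prod H (fixed_center \<alpha>))"

definition module_cat ::
    "('g::{topological_group_add, t2_space} \<Rightarrow> 'a::cstar_algebra \<Rightarrow> 'a)
      \<Rightarrow> (('a, 'a) hmod, 'a \<Rightarrow> 'a) cat" where
  "module_cat \<alpha> =
     \<lparr>Obj = assoc_module \<alpha> ` {H. inv_ahs \<alpha> H},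
      Hom = (\<lambda>M N. {T \<in> right_linear_maps (fixed_center \<alpha>) M N.
               \<forall>g. \<forall>x\<in>hcarrier M. T (\<alpha> g x) = \<alpha> g (T x)}),
      Ident = (\<lambda>M. \<lambda>x\<in>hcarrier M. x),
      Comp = (\<lambda>M N P S T. compose (hcarrier M) S T)\<rparr>"

text \<open>Entry \<open>Z\<^sub>j\<^sub>k\<close> of the matrix of \<open>T\<close>, i.e. \<open>T \<Phi>\<^sub>k = \<Sum>\<^sub>j \<Psi>\<^sub>j Z\<^sub>j\<^sub>k\<close> for the basis \<open>\<Psi>\<close> of the target.\<close>

definition operator_matrix ::
    "('a, 'n) hmod \<Rightarrow> (nat \<Rightarrow> 'n) \<Rightarrow> (nat \<Rightarrow> 'm) \<Rightarrow> ('m \<Rightarrow> 'n) \<Rightarrow> nat \<Rightarrow> nat \<Rightarrow> 'a" where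
  "operator_matrix N \<Psi> \<Phi> T j k = hinner N (\<Psi> j) (T (\<Phi> k))"

end

theory Submission
  imports Defs
begin

text \<open>
  The module \<open>\<H>\<Z>\<close> is recovered from the endomorphism alone: it is the set of all \<open>x\<close> with
  \<open>x a = \<rho> a x\<close> for every fixed \<open>a\<close>. Indeed, for such \<open>x\<close> the coefficients \<open>\<Phi>\<^sub>j\<^sup>\<star> x\<close> commute with the
  fixed point algebra, so by minimality they lie in \<open>\<Z>\<close>, and \<open>x = \<Sum>\<^sub>j \<Phi>\<^sub>j (\<Phi>\<^sub>j\<^sup>\<star> x)\<close> because the support
  is \<open>1\<close>. The support condition also shows that \<open>X\<close> is determined by its left multiplication on \<open>\<H>\<Z>\<close>;
  an invariant module map \<open>T\<close> is left multiplication by exactly one \<open>X\<close>, and this \<open>X\<close> is \<open>\<J> T\<close>.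
\<close>

section \<open>C*-algebras and orthonormal families\<close>

text \<open>Different invariant Hilbert spaces can have the same canonical endomorphism, and a
  module basis of \<open>span_prod H \<Z>\<close> need not lie in the chosen H. Objects and arrows
  are therefore compared through the sets \<open>intertwined \<sigma>\<close>, which mention neither
  H nor a basis. These sets are cut out by continuous linear equations, so they are closed subspaces
  and the modules are complete in the norm of the algebra. They can also be computed for a sum or a
  composite of endomorphisms without choosing a Hilbert space. A correspondence of objects then asks
  for just one Hilbert space with the given endomorphism, spanned by the \<open>V * \<Phi> i\<close>
  and \<open>W * \<Psi> j\<close> for a sum and by the \<open>\<Phi> i * \<Psi> j\<close> for a
  composite. The abstract tensor product is carried into the algebra by multiplication: its form is
  a pullback, its null vectors are the kernel, and the image is already complete.\<close>

lemma adj_one [simp]: "(1::'a::cstar_algebra)\<^sup>\<star> = 1"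
  by (metis adj_adj adj_mult mult.right_neutral)

lemma adj_zero [simp]: "(0::'a::cstar_algebra)\<^sup>\<star> = 0"
  using adj_add[of "0::'a" 0] by simp

lemma adj_sum: "(sum f I)\<^sup>\<star> = (\<Sum>i\<in>I. (f i::'a::cstar_algebra)\<^sup>\<star>)"
  by (induction I rule: infinite_finite_induct) (simp_all add: adj_add)

lemma adj_mult_self_eq_0_iff [simp]: "x\<^sup>\<star> * x = 0 \<longleftrightarrow> (x::'a::cstar_algebra) = 0"
  using cstar_identity[of x] by auto

text \<open>The product is linear in each factor, so span minimality is applied twice: in the right
  factor beside a generator, then in the left factor.\<close>

lemma span_times_span:
  assumes "x \<in> cvec.span S" "y \<in> cvec.span T"
  shows "x * y \<in> span_prod S (T::'a::cstar_algebra set)"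
proof -
  let ?V = "span_prod S T"
  have V: "cvec.subspace ?V"
    unfolding span_prod_def by (rule cvec.subspace_span)
  have "s * y \<in> ?V" if s: "s \<in> S" for s
  proof -
    have "cvec.subspace {y. s * y \<in> ?V}"
      using V by (auto simp: cvec.subspace_def distrib_left mult_cscale_right)
    moreover have "T \<subseteq> {y. s * y \<in> ?V}"
      using s by (auto simp: span_prod_def intro!: cvec.span_base)
    ultimately show ?thesis
      using cvec.span_minimal assms(2) by blast
  qed
  then have "S \<subseteq> {x. x * y \<in> ?V}" by blast
  moreover have "cvec.subspace {x. x * y \<in> ?V}"
    using V by (auto simp: cvec.subspace_def distrib_right mult_cscale_left)
  ultimately show ?thesis
    using cvec.span_minimal assms(1) by blast
qed

text \<open>Arbitrary index sets let disjoint unions and Cartesian products index the bases of sums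
  and products.\<close>

definition orthonormal_on :: "'i set \<Rightarrow> ('i \<Rightarrow> 'a::cstar_algebra) \<Rightarrow> bool" where
  "orthonormal_on I \<Phi> \<longleftrightarrow> finite I \<and> (\<forall>i\<in>I. \<forall>j\<in>I. (\<Phi> i)\<^sup>\<star> * \<Phi> j = (if i = j then 1 else 0))"

definition support :: "'i set \<Rightarrow> ('i \<Rightarrow> 'a::cstar_algebra) \<Rightarrow> 'a" where
  "support I \<Phi> = (\<Sum>i\<in>I. \<Phi> i * (\<Phi> i)\<^sup>\<star>)"

text \<open>The formula of the canonical endomorphism, on the whole algebra. Its value at 1 is the
  support, so facts about supports are instances of facts about \<open>sandwich\<close>.\<close>

definition sandwich :: "'i set \<Rightarrow> ('i \<Rightarrow> 'a::cstar_algebra) \<Rightarrow> 'a \<Rightarrow> 'a" where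
  "sandwich I \<Phi> a = (\<Sum>i\<in>I. \<Phi> i * a * (\<Phi> i)\<^sup>\<star>)"

lemma orthonormal_basis_iff:
  "orthonormal_basis H n \<Phi> \<longleftrightarrow> H = cvec.span (\<Phi> ` {..<n}) \<and> orthonormal_on {..<n} \<Phi>"
  by (auto simp: orthonormal_basis_def orthonormal_on_def)

lemma sandwich_one: "sandwich I \<Phi> 1 = support I \<Phi>"
  by (simp add: sandwich_def support_def)

lemma sandwich_adj: "(sandwich I \<Phi> a)\<^sup>\<star> = sandwich I \<Phi> (a\<^sup>\<star>)"
  by (simp add: sandwich_def adj_sum adj_mult adj_adj mult.assoc)

lemma sandwich_mult:
  assumes "orthonormal_on I \<Phi>" "i \<in> I"
  shows "sandwich I \<Phi> a * \<Phi> i = \<Phi> i * a"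
proof -
  have "sandwich I \<Phi> a * \<Phi> i = (\<Sum>j\<in>I. \<Phi> j * a * ((\<Phi> j)\<^sup>\<star> * \<Phi> i))"
    by (simp add: sandwich_def sum_distrib_right mult.assoc)
  also have "\<dots> = (\<Sum>j\<in>I. if j = i then \<Phi> i * a else 0)"
    using assms by (intro sum.cong refl) (auto simp: orthonormal_on_def)
  also have "\<dots> = \<Phi> i * a"
    using assms by (simp add: orthonormal_on_def)
  finally show ?thesis .
qed

lemma sandwich_intertwines_span:
  assumes "orthonormal_on I \<Phi>" "x \<in> cvec.span (\<Phi> ` I)"
  shows "x * a = sandwich I \<Phi> a * x"
proof -
  let ?V = "{x. x * a = sandwich I \<Phi> a * x}"
  have "cvec.subspace ?V"
    by (auto simp: cvec.subspace_def distrib_left distrib_right mult_cscale_right mult_cscale_left)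
  moreover have "\<Phi> ` I \<subseteq> ?V"
    using sandwich_mult[OF assms(1)] by auto
  ultimately show ?thesis
    using cvec.span_minimal assms(2) by blast
qed

lemma support_mult_span:
  assumes "orthonormal_on I \<Phi>" "x \<in> cvec.span (\<Phi> ` I)"
  shows "support I \<Phi> * x = x"
  using sandwich_intertwines_span[OF assms, of 1] by (simp add: sandwich_one)

text \<open>An element whose left multiplication fixes a family with support 1 also fixes that
  support, hence equals 1. This carries full support from one family to another.\<close>

lemma support_eq_one_if:
  assumes "support J \<Psi> = 1" "\<And>j. j \<in> J \<Longrightarrow> support I \<Phi> * \<Psi> j = \<Psi> j"
  shows "support I \<Phi> = 1"
proof -
  have "support I \<Phi> = support I \<Phi> * support J \<Psi>" using assms by simp
  also have "\<dots> = support J \<Psi>"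
    unfolding support_def[of J] sum_distrib_left
    by (intro sum.cong refl) (simp add: assms(2) flip: mult.assoc)
  finally show ?thesis using assms by simp
qed

lemma cancel_if_support_one:
  assumes "support I \<Phi> = 1" "\<And>i. i \<in> I \<Longrightarrow> X * \<Phi> i = Y * \<Phi> i"
  shows "X = Y"
proof -
  have "X = X * support I \<Phi>" "Y = Y * support I \<Phi>" using assms by simp_all
  moreover have "X * support I \<Phi> = Y * support I \<Phi>"
    by (simp add: support_def sum_distrib_left assms(2) flip: mult.assoc)
  ultimately show ?thesis by simp
qed

text \<open>Uniqueness: under full support, b is the sum of the
  \<open>b * \<Phi> i * (\<Phi> i)\<^sup>\<star>\<close>, so the relations determine it. This is how
  an endomorphism is read off from its intertwiners.\<close>

lemma sandwich_eq_if_intertwines: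
  assumes "support I \<Phi> = 1" "\<And>i. i \<in> I \<Longrightarrow> \<Phi> i * a = b * \<Phi> i"
  shows "sandwich I \<Phi> a = b"
proof -
  have "sandwich I \<Phi> a = b * support I \<Phi>"
    by (simp add: sandwich_def support_def sum_distrib_left assms(2) mult.assoc)
  then show ?thesis using assms by simp
qed

lemma expand_if_support_one:
  assumes "support I \<Phi> = 1"
  shows "x = (\<Sum>i\<in>I. \<Phi> i * ((\<Phi> i)\<^sup>\<star> * x))"
proof -
  have "x = support I \<Phi> * x" using assms by simp
  then show ?thesis by (simp add: support_def sum_distrib_right mult.assoc)
qed

lemma subspace_mult_scalar: "cvec.subspace {y. \<exists>c. b * y = c *\<^sub>C (1::'a::cstar_algebra)}"
  unfolding cvec.subspace_def mem_Collect_eq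
proof (intro conjI allI ballI)
  show "\<exists>c. b * 0 = c *\<^sub>C 1" by (rule exI[of _ 0]) simp
  fix x assume "x \<in> {y. \<exists>c. b * y = c *\<^sub>C (1::'a)}"
  then obtain c where c: "b * x = c *\<^sub>C 1" by auto
  show "\<exists>d. b * e *\<^sub>C x = d *\<^sub>C 1" for e
    by (rule exI[of _ "e * c"]) (simp add: mult_cscale_right c cscale_cscale)
  fix y assume "y \<in> {y. \<exists>c. b * y = c *\<^sub>C (1::'a)}"
  then obtain d where "b * y = d *\<^sub>C 1" by auto
  then show "\<exists>d. b * (x + y) = d *\<^sub>C 1"
    by (intro exI[of _ "c + d"]) (simp add: distrib_left c cscale_add_left)
qed

lemma adj_mult_scalar_commute:
  assumes "x\<^sup>\<star> * y = c *\<^sub>C (1::'a::cstar_algebra)"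
  shows "y\<^sup>\<star> * x = cnj c *\<^sub>C 1"
  using arg_cong[OF assms, of adj] by (simp add: adj_mult adj_adj adj_cscale)

text \<open>The form is conjugate linear on the left. So one extends linearly on the right, swaps
  the factors by taking adjoints, and extends on the right again.\<close>

lemma orthonormal_on_span_inner:
  assumes "orthonormal_on I \<Phi>" "x \<in> cvec.span (\<Phi> ` I)" "y \<in> cvec.span (\<Phi> ` I)"
  shows "\<exists>c. x\<^sup>\<star> * y = c *\<^sub>C 1"
proof -
  have extend: "\<exists>c. b * y = c *\<^sub>C 1"
    if "\<forall>j\<in>I. \<exists>c. b * \<Phi> j = c *\<^sub>C 1" "y \<in> cvec.span (\<Phi> ` I)" for b y
    using cvec.span_minimal[OF _ subspace_mult_scalar[of b], of "\<Phi> ` I"] that by blast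
  have "\<exists>c. (\<Phi> i)\<^sup>\<star> * \<Phi> j = c *\<^sub>C 1" if "i \<in> I" "j \<in> I" for i j
    using assms(1) that by (intro exI[of _ "if i = j then 1 else 0"]) (simp add: orthonormal_on_def)
  then have "\<exists>c. (\<Phi> i)\<^sup>\<star> * x = c *\<^sub>C 1" if "i \<in> I" for i
    using extend assms(2) that by blast
  then have "\<exists>c. x\<^sup>\<star> * \<Phi> i = c *\<^sub>C 1" if "i \<in> I" for i
    using adj_mult_scalar_commute that by blast
  then show ?thesis using extend assms(3) by blast
qed

text \<open>Returns to the initial segments of the naturals that \<open>orthonormal_basis\<close>
  demands.\<close>

lemma orthonormal_on_reindex:
  assumes "orthonormal_on I \<Phi>"
  obtains n \<Psi> where "orthonormal_on {..<n} \<Psi>" "\<Psi> ` {..<n::nat} = \<Phi> ` I"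
    "support {..<n} \<Psi> = support I \<Phi>"
proof -
  obtain b where b: "bij_betw b {..<card I} I"
    using assms ex_bij_betw_nat_finite[of I] by (auto simp: orthonormal_on_def atLeast0LessThan)
  have "b i = b j \<longleftrightarrow> i = j" "b i \<in> I" if "i < card I" "j < card I" for i j
    using b that by (auto simp: bij_betw_def inj_on_eq_iff)
  then have "orthonormal_on {..<card I} (\<Phi> \<circ> b)"
    using assms by (auto simp: orthonormal_on_def)
  moreover have "(\<Phi> \<circ> b) ` {..<card I} = \<Phi> ` I"
    using b by (metis bij_betw_imp_surj_on image_comp)
  moreover have "support {..<card I} (\<Phi> \<circ> b) = support I \<Phi>"
    unfolding support_def comp_def by (rule sum.reindex_bij_betw[OF b])
  ultimately show thesis by (rule that)
qed

section \<open>Algebraic Hilbert spaces and independence of the basis\<close>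

lemma algebraic_hilbert_space_span:
  assumes "orthonormal_on I \<Phi>" "support I \<Phi> = 1"
  shows "algebraic_hilbert_space (cvec.span (\<Phi> ` I))"
proof -
  obtain n :: nat and \<Psi> where "orthonormal_on {..<n} \<Psi>" "\<Psi> ` {..<n} = \<Phi> ` I"
    "support {..<n} \<Psi> = support I \<Phi>"
    by (rule orthonormal_on_reindex[OF assms(1)])
  then have "\<exists>n \<Psi>. orthonormal_basis (cvec.span (\<Phi> ` I)) n \<Psi> \<and> (\<Sum>j<n. \<Psi> j * (\<Psi> j)\<^sup>\<star>) = 1"
    using assms(2) by (intro exI[of _ n] exI[of _ \<Psi>]) (simp add: orthonormal_basis_iff support_def)
  moreover have "\<exists>B. finite B \<and> cvec.span B = cvec.span (\<Phi> ` I)"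
    using assms(1) by (auto simp: orthonormal_on_def)
  ultimately show ?thesis
    using orthonormal_on_span_inner[OF assms(1)]
    by (auto simp: algebraic_hilbert_space_def cvec.subspace_span)
qed

lemma orthonormal_basis_mem: "orthonormal_basis H n \<Phi> \<Longrightarrow> j \<in> {..<n} \<Longrightarrow> \<Phi> j \<in> H"
  by (simp add: orthonormal_basis_iff cvec.span_base)

lemma algebraic_hilbert_spaceE:
  assumes "algebraic_hilbert_space H"
  obtains n \<Phi> where "orthonormal_basis H n \<Phi>" "support {..<n} \<Phi> = 1"
  using assms unfolding algebraic_hilbert_space_def support_def by blast

text \<open>The definition grants full support to one orthonormal basis only. Its members lie in the
  span of any other one, whose support therefore fixes them.\<close>

lemma orthonormal_basis_support:
  assumes "algebraic_hilbert_space H" "orthonormal_basis H n \<Phi>"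
  shows "support {..<n} \<Phi> = 1"
proof -
  obtain m \<Psi> where \<Psi>: "orthonormal_basis H m \<Psi>" "support {..<m} \<Psi> = 1"
    using assms(1) by (rule algebraic_hilbert_spaceE)
  show ?thesis
  proof (rule support_eq_one_if[OF \<Psi>(2)])
    fix j assume "j \<in> {..<m}"
    then have "\<Psi> j \<in> cvec.span (\<Phi> ` {..<n})"
      using \<Psi>(1) assms(2) orthonormal_basis_mem unfolding orthonormal_basis_iff[of H n] by blast
    then show "support {..<n} \<Phi> * \<Psi> j = \<Psi> j"
      using assms(2) support_mult_span by (auto simp: orthonormal_basis_iff)
  qed
qed

text \<open>
  Elements of a finite-dimensional \<open>H\<close> commute with arbitrary \<open>a\<close> up to \<open>a \<mapsto> sandwich I \<Phi> a\<close>; full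
  support then makes that map independent of the basis.
\<close>

lemma sandwich_basis_independent:
  assumes "orthonormal_on I \<Phi>" "support J \<Psi> = 1" "\<Psi> ` J \<subseteq> cvec.span (\<Phi> ` I)"
  shows "sandwich J \<Psi> a = sandwich I \<Phi> a"
  using assms sandwich_intertwines_span[OF assms(1)]
  by (intro sandwich_eq_if_intertwines[OF assms(2)]) auto

text \<open>Frees the endomorphism from the basis picked by \<open>SOME\<close>.\<close>

lemma canonical_endo_eq:
  assumes "algebraic_hilbert_space H" "H = cvec.span (\<Phi> ` I)" "orthonormal_on I \<Phi>"
    "a \<in> fixed_algebra \<alpha>"
  shows "canonical_endo \<alpha> H a = sandwich I \<Phi> a"
proof -
  define p where "p = (SOME (n, \<Phi>). orthonormal_basis H n \<Phi>)"
  obtain n \<Psi> where p: "p = (n, \<Psi>)" by fastforce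
  have "\<exists>q. case q of (n, \<Phi>) \<Rightarrow> orthonormal_basis H n \<Phi>"
    using assms(1) by (rule algebraic_hilbert_spaceE) auto
  then have \<Psi>: "orthonormal_basis H n \<Psi>"
    using someI_ex[of "\<lambda>(n, \<Phi>). orthonormal_basis H n \<Phi>"] p by (auto simp: p_def)
  then have "sandwich {..<n} \<Psi> a = sandwich I \<Phi> a"
    using orthonormal_basis_support[OF assms(1) \<Psi>] orthonormal_basis_mem[OF \<Psi>] assms(2,3)
    by (intro sandwich_basis_independent) blast+
  then show ?thesis
    using assms(4) p by (simp add: canonical_endo_def sandwich_def p_def[symmetric])
qed

section \<open>Modules of intertwiners\<close>

lemma concrete_module_simps:
  "hcarrier (concrete_module S) = S" "hadd (concrete_module S) = (+)"
  "hzero (concrete_module S) = 0" "hsmul (concrete_module S) = (*)"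
  "hinner (concrete_module S) x y = x\<^sup>\<star> * y" "hleft (concrete_module S) = (*)"
  by (simp_all add: concrete_module_def)

lemma hgroup_concrete:
  assumes "cvec.subspace S"
  shows "comm_group (hgroup (concrete_module S))"
proof (rule comm_groupI)
  fix x assume "x \<in> carrier (hgroup (concrete_module S))"
  then show "\<exists>y\<in>carrier (hgroup (concrete_module S)).
      y \<otimes>\<^bsub>hgroup (concrete_module S)\<^esub> x = \<one>\<^bsub>hgroup (concrete_module S)\<^esub>"
    using assms by (intro bexI[of _ "- x"])
      (auto simp: hgroup_def concrete_module_def cvec.subspace_neg)
qed (use assms in \<open>auto simp: hgroup_def concrete_module_def cvec.subspace_def add.assoc add.commute\<close>)

lemma finprod_concrete:
  assumes "cvec.subspace S" "finite I" "f \<in> I \<rightarrow> S"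
  shows "finprod (hgroup (concrete_module S)) f I = sum f I"
proof -
  interpret comm_group "hgroup (concrete_module S)" by (rule hgroup_concrete[OF assms(1)])
  show ?thesis
    using assms(2,3)
  proof (induction I rule: finite_induct)
    case empty
    have "finprod (hgroup (concrete_module S)) f {} = \<one>\<^bsub>hgroup (concrete_module S)\<^esub>"
      by (rule finprod_empty)
    then show ?case by (simp add: hgroup_def concrete_module_def)
  next
    case (insert i I)
    have "finprod (hgroup (concrete_module S)) f (insert i I)
        = f i \<otimes>\<^bsub>hgroup (concrete_module S)\<^esub> finprod (hgroup (concrete_module S)) f I"
      using insert by (intro finprod_insert) (auto simp: hgroup_def concrete_module_def)
    then show ?case using insert by (simp add: hgroup_def concrete_module_def)
  qed
qed

lemma category_free_bimodule_cat: "category (free_bimodule_cat Z)"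
proof -
  have "hadd M x y \<in> hcarrier M" "z \<in> Z \<Longrightarrow> hsmul M x z \<in> hcarrier M"
    if M: "free_hilbert_bimodule Z M" "x \<in> hcarrier M" "y \<in> hcarrier M"
    for M :: "('a::cstar_algebra, 'm) hmod" and x y z
  proof -
    have r: "right_module Z M"
      using M by (auto simp: free_hilbert_bimodule_def hilbert_bimodule_def hilbert_module_def)
    then interpret comm_group "hgroup M" by (simp add: right_module_def)
    show "hadd M x y \<in> hcarrier M" using m_closed[of x y] M by (simp add: hgroup_def)
    show "z \<in> Z \<Longrightarrow> hsmul M x z \<in> hcarrier M" using r M by (simp add: right_module_def)
  qed
  note closed = this
  show ?thesis
    unfolding category_def free_bimodule_cat_def right_linear_maps_def
    by (auto simp: closed compose_def PiE_iff extensional_def fun_eq_iff)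
qed

section \<open>The group action, the fixed point algebra and its center\<close>

locale minimal_system =
  fixes \<alpha> :: "'g::{topological_group_add, t2_space} \<Rightarrow> 'f::cstar_algebra \<Rightarrow> 'f"
  assumes minimal: "minimal_hilbert_cstar_system \<alpha>"
begin

abbreviation "\<A> \<equiv> fixed_algebra \<alpha>"
abbreviation "\<Z> \<equiv> fixed_center \<alpha>"
abbreviation "\<rho> \<equiv> canonical_endo \<alpha>"

text \<open>Here \<open>\<sigma>\<close> is any function, so the set makes sense for a sum or
  composite not yet known to be canonical.\<close>

definition intertwined :: "('f \<Rightarrow> 'f) \<Rightarrow> 'f set" where
  "intertwined \<sigma> = {x. \<forall>a\<in>\<A>. x * a = \<sigma> a * x}"

abbreviation "\<M> H \<equiv> intertwined (\<rho> H)"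

lemma commutant_eq_center: "commutant \<A> = \<Z>"
  using minimal by (simp add: minimal_hilbert_cstar_system_def)

lemma dynamical: "cstar_dynamical_system \<alpha>"
  using minimal by (simp add: minimal_hilbert_cstar_system_def hilbert_cstar_system_def)

lemma alpha_automorphism: "star_automorphism (\<alpha> g)"
  using dynamical by (simp add: cstar_dynamical_system_def)

lemma alpha_add: "\<alpha> g (x + y) = \<alpha> g x + \<alpha> g y"
  and alpha_cscale: "\<alpha> g (c *\<^sub>C x) = c *\<^sub>C \<alpha> g x"
  and alpha_mult: "\<alpha> g (x * y) = \<alpha> g x * \<alpha> g y"
  and alpha_adj: "\<alpha> g (x\<^sup>\<star>) = (\<alpha> g x)\<^sup>\<star>"
  and bij_alpha: "bij (\<alpha> g)"
  using alpha_automorphism[of g] by (simp_all add: star_automorphism_def)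

lemma alpha_zero [simp]: "\<alpha> g 0 = 0"
  using alpha_add[of g 0 0] by simp

text \<open>\<open>star_automorphism\<close> does not state unitality. It follows from surjectivity,
  since \<open>\<alpha> g 1\<close> is a left unit for a preimage value 1.\<close>

lemma alpha_one [simp]: "\<alpha> g 1 = 1"
proof -
  obtain y where "\<alpha> g y = 1" using bij_alpha[of g] by (metis bij_pointE)
  then show ?thesis using alpha_mult[of g 1 y] by simp
qed

lemma alpha_sum: "\<alpha> g (sum f I) = (\<Sum>i\<in>I. \<alpha> g (f i))"
  by (induction I rule: infinite_finite_induct) (simp_all add: alpha_add)

lemma alpha_cancel [simp]: "\<alpha> g (\<alpha> (- g) x) = x"
proof -
  have comp: "\<alpha> (g + h) x = \<alpha> g (\<alpha> h x)" for g h x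
    using dynamical by (simp add: cstar_dynamical_system_def)
  \<comment> \<open>An idempotent injective map is the identity.\<close>
  have "\<alpha> 0 (\<alpha> 0 x) = \<alpha> 0 x" using comp[of 0 0 x] by simp
  then have "\<alpha> 0 x = x" using bij_alpha[of 0] by (auto simp: bij_def inj_eq)
  then show ?thesis using comp[of g "- g" x] by simp
qed

lemma alpha_sandwich: "\<alpha> g (sandwich I \<Phi> a) = sandwich I (\<alpha> g \<circ> \<Phi>) (\<alpha> g a)"
  by (simp add: sandwich_def alpha_sum alpha_mult alpha_adj)

lemma fixed_one: "1 \<in> \<A>"
  and fixed_mult: "a \<in> \<A> \<Longrightarrow> b \<in> \<A> \<Longrightarrow> a * b \<in> \<A>"
  and fixed_adj: "a \<in> \<A> \<Longrightarrow> a\<^sup>\<star> \<in> \<A>"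
  and alpha_fixed: "a \<in> \<A> \<Longrightarrow> \<alpha> g a = a"
  by (simp_all add: fixed_algebra_def alpha_mult alpha_adj)

text \<open>Minimality at work: an element commuting with the fixed point algebra is itself fixed by
  the group.\<close>

lemma center_iff: "z \<in> \<Z> \<longleftrightarrow> (\<forall>a\<in>\<A>. z * a = a * z)"
  by (simp add: commutant_def flip: commutant_eq_center)

lemma center_zero: "0 \<in> \<Z>"
  by (simp add: center_iff)

lemma intertwined_subspace: "cvec.subspace (intertwined \<sigma>)"
  by (auto simp: intertwined_def cvec.subspace_def distrib_left distrib_right
      mult_cscale_left mult_cscale_right)

lemma intertwined_mult: "x \<in> intertwined \<sigma> \<Longrightarrow> a \<in> \<A> \<Longrightarrow> x * a = \<sigma> a * x"
  by (simp add: intertwined_def)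

lemma intertwined_right: "x \<in> intertwined \<sigma> \<Longrightarrow> z \<in> \<Z> \<Longrightarrow> x * z \<in> intertwined \<sigma>"
  unfolding intertwined_def mem_Collect_eq by (metis mult.assoc center_iff)

section \<open>Invariant Hilbert spaces and their intertwiners\<close>

lemma inv_ahsE:
  assumes "inv_ahs \<alpha> H"
  obtains n :: nat and \<Phi> where "orthonormal_on {..<n} \<Phi>" "support {..<n} \<Phi> = 1"
    "H = cvec.span (\<Phi> ` {..<n})" "\<And>i. i \<in> {..<n} \<Longrightarrow> \<Phi> i \<in> H"
    "\<And>a. a \<in> \<A> \<Longrightarrow> \<rho> H a = sandwich {..<n} \<Phi> a"
proof -
  have H: "algebraic_hilbert_space H" using assms by (simp add: inv_ahs_def)
  obtain n \<Phi> where \<Phi>: "orthonormal_basis H n \<Phi>" "support {..<n} \<Phi> = 1"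
    using H by (rule algebraic_hilbert_spaceE)
  then have *: "orthonormal_on {..<n} \<Phi>" "H = cvec.span (\<Phi> ` {..<n})"
    unfolding orthonormal_basis_iff by blast+
  show thesis
    using that[OF *(1) \<Phi>(2) *(2) orthonormal_basis_mem[OF \<Phi>(1)] canonical_endo_eq[OF H *(2,1)]]
    by blast
qed

text \<open>A group element moves the basis to another family in H with full support, and the
  endomorphism does not depend on that choice.\<close>

lemma endo_fixed:
  assumes "inv_ahs \<alpha> H" "a \<in> \<A>"
  shows "\<rho> H a \<in> \<A>"
proof -
  obtain n :: nat and \<Phi> where \<Phi>: "orthonormal_on {..<n} \<Phi>" "support {..<n} \<Phi> = 1"
    "H = cvec.span (\<Phi> ` {..<n})" "\<And>i. i \<in> {..<n} \<Longrightarrow> \<Phi> i \<in> H"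
    "\<rho> H a = sandwich {..<n} \<Phi> a"
    using inv_ahsE[OF assms(1)] assms(2) by metis
  have "\<alpha> g (sandwich {..<n} \<Phi> a) = sandwich {..<n} \<Phi> a" for g
  proof -
    have supp: "support {..<n} (\<alpha> g \<circ> \<Phi>) = 1"
      using \<Phi>(2) alpha_sandwich[of g "{..<n}" \<Phi> 1] by (simp add: sandwich_one)
    have span: "(\<alpha> g \<circ> \<Phi>) ` {..<n} \<subseteq> cvec.span (\<Phi> ` {..<n})"
      using assms(1) \<Phi>(3,4) by (auto simp: inv_ahs_def invariant_def)
    show ?thesis
      unfolding alpha_sandwich alpha_fixed[OF assms(2)]
      by (rule sandwich_basis_independent[OF \<Phi>(1) supp span])
  qed
  then show ?thesis by (simp add: fixed_algebra_def \<Phi>(5))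
qed

lemma endo_adj:
  assumes "inv_ahs \<alpha> H" "a \<in> \<A>"
  shows "(\<rho> H a)\<^sup>\<star> = \<rho> H (a\<^sup>\<star>)"
  using assms(1) by (rule inv_ahsE) (simp add: assms(2) fixed_adj sandwich_adj)

lemma hilbert_space_intertwined:
  assumes "inv_ahs \<alpha> H"
  shows "H \<subseteq> \<M> H"
  using assms by (rule inv_ahsE) (auto simp: intertwined_def sandwich_intertwines_span)

text \<open>The adjoint of the relation for x reads
  \<open>x\<^sup>\<star> * \<rho> H a = a * x\<^sup>\<star>\<close>, so a passes through both
  factors.\<close>

lemma intertwined_inner:
  assumes "inv_ahs \<alpha> H" "x \<in> \<M> H" "y \<in> \<M> H"
  shows "x\<^sup>\<star> * y \<in> \<Z>"
  unfolding center_iff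
proof
  fix a assume a: "a \<in> \<A>"
  have "x\<^sup>\<star> * y * a = x\<^sup>\<star> * (\<rho> H a * y)"
    using assms(3) a by (simp add: mult.assoc intertwined_mult)
  also have "\<dots> = ((\<rho> H a)\<^sup>\<star> * x)\<^sup>\<star> * y"
    by (simp add: adj_mult adj_adj mult.assoc)
  also have "\<dots> = (x * a\<^sup>\<star>)\<^sup>\<star> * y"
    using assms a by (simp add: endo_adj intertwined_mult fixed_adj)
  finally show "x\<^sup>\<star> * y * a = a * (x\<^sup>\<star> * y)"
    by (simp add: adj_mult adj_adj mult.assoc)
qed

text \<open>Minimality enters here: the coefficients \<open>\<Phi>\<^sub>i\<^sup>\<star> x\<close> commute with the fixed point algebra.\<close>

lemma span_prod_center:
  assumes "inv_ahs \<alpha> H"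
  shows "span_prod H \<Z> = \<M> H"
proof
  show "span_prod H \<Z> \<subseteq> \<M> H"
    unfolding span_prod_def using hilbert_space_intertwined[OF assms]
    by (intro cvec.span_minimal intertwined_subspace) (auto intro: intertwined_right)
next
  obtain n :: nat and \<Phi> where \<Phi>: "support {..<n} \<Phi> = 1" "\<And>i. i \<in> {..<n} \<Longrightarrow> \<Phi> i \<in> H"
    using inv_ahsE[OF assms] by metis
  show "\<M> H \<subseteq> span_prod H \<Z>"
  proof
    fix x assume x: "x \<in> \<M> H"
    have "(\<Sum>i<n. \<Phi> i * ((\<Phi> i)\<^sup>\<star> * x)) \<in> span_prod H \<Z>"
      unfolding span_prod_def
      using \<Phi>(2) hilbert_space_intertwined[OF assms] intertwined_inner[OF assms _ x]
      by (intro cvec.span_sum cvec.span_base) blast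
    then show "x \<in> span_prod H \<Z>"
      using expand_if_support_one[OF \<Phi>(1), of x] by simp
  qed
qed

lemma assoc_module_eq: "inv_ahs \<alpha> H \<Longrightarrow> assoc_module \<alpha> H = concrete_module (\<M> H)"
  by (simp add: assoc_module_def span_prod_center)

lemma hcarrier_assoc: "inv_ahs \<alpha> H \<Longrightarrow> hcarrier (assoc_module \<alpha> H) = \<M> H"
  by (simp add: assoc_module_eq concrete_module_def)

lemma endo_extensional: "\<rho> H \<in> extensional \<A>"
  by (simp add: canonical_endo_def)

text \<open>One inclusion suffices: it makes a basis of H obey the relations of
  \<open>\<sigma>\<close>, and full support then determines \<open>\<sigma>\<close>.\<close>

lemma endo_eq_if_intertwined_eq:
  assumes "inv_ahs \<alpha> H" "\<M> H \<subseteq> intertwined \<sigma>" "\<sigma> \<in> extensional \<A>"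
  shows "\<rho> H = \<sigma>"
proof (rule extensionalityI[OF endo_extensional assms(3)])
  fix a assume a: "a \<in> \<A>"
  obtain n :: nat and \<Phi> where \<Phi>: "support {..<n} \<Phi> = 1" "\<And>i. i \<in> {..<n} \<Longrightarrow> \<Phi> i \<in> H"
    "\<rho> H a = sandwich {..<n} \<Phi> a"
    using inv_ahsE[OF assms(1)] a by metis
  show "\<rho> H a = \<sigma> a"
    unfolding \<Phi>(3) using \<Phi>(2) hilbert_space_intertwined[OF assms(1)] assms(2) a
    by (intro sandwich_eq_if_intertwines[OF \<Phi>(1)] intertwined_mult) auto
qed

text \<open>Well-definedness and injectivity of the object map in one statement.\<close>

lemma assoc_module_eq_iff:
  assumes "inv_ahs \<alpha> H1" "inv_ahs \<alpha> H2"
  shows "assoc_module \<alpha> H1 = assoc_module \<alpha> H2 \<longleftrightarrow> \<rho> H1 = \<rho> H2"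
  using assms endo_eq_if_intertwined_eq[OF assms(1) _ endo_extensional[of H2]] hcarrier_assoc
  by (metis assoc_module_eq order_refl)

text \<open>The endomorphism takes values in the fixed point algebra, with which z commutes.\<close>

lemma intertwined_left:
  assumes "inv_ahs \<alpha> H" "x \<in> \<M> H" "z \<in> \<Z>"
  shows "z * x \<in> \<M> H"
  unfolding intertwined_def mem_Collect_eq
proof
  fix a assume a: "a \<in> \<A>"
  have "z * x * a = z * \<rho> H a * x"
    using assms(2) a by (simp add: mult.assoc intertwined_mult)
  also have "z * \<rho> H a = \<rho> H a * z"
    using assms(3) endo_fixed[OF assms(1) a] by (simp add: center_iff)
  finally show "z * x * a = \<rho> H a * (z * x)" by (simp add: mult.assoc)
qed

lemma intertwined_alpha:
  assumes "inv_ahs \<alpha> H" "x \<in> \<M> H"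
  shows "\<alpha> g x \<in> \<M> H"
  unfolding intertwined_def mem_Collect_eq
proof
  fix a assume a: "a \<in> \<A>"
  have "\<alpha> g x * a = \<alpha> g (x * a)" using a by (simp add: alpha_mult alpha_fixed)
  also have "\<dots> = \<alpha> g (\<rho> H a * x)" using assms(2) a by (simp add: intertwined_mult)
  also have "\<dots> = \<rho> H a * \<alpha> g x"
    using endo_fixed[OF assms(1) a] by (simp add: alpha_mult alpha_fixed)
  finally show "\<alpha> g x * a = \<rho> H a * \<alpha> g x" .
qed

lemma intertwined_closed: "closed (intertwined \<sigma>)"
proof -
  have "intertwined \<sigma> = (\<Inter>a\<in>\<A>. {x. x * a = \<sigma> a * x})" by (auto simp: intertwined_def)
  moreover have "closed {x. x * a = \<sigma> a * x}" for a
    by (intro closed_Collect_eq continuous_intros)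
  ultimately show ?thesis by (simp add: closed_INT)
qed

section \<open>Completeness, bimodule structure and module bases\<close>

lemma hnorm_concrete: "hnorm (concrete_module S) x = norm (x::'f)"
  by (simp add: hnorm_def concrete_module_def cstar_identity)

lemma hminus_concrete: "hminus (concrete_module S) x y = x - (y::'f)"
  by (simp add: hminus_def concrete_module_def)

lemma hilbert_module_intertwined:
  assumes "inv_ahs \<alpha> H"
  shows "hilbert_module \<Z> (concrete_module (\<M> H))"
  unfolding hilbert_module_def
proof (intro conjI)
  show "right_module \<Z> (concrete_module (\<M> H))"
    unfolding right_module_def
    by (simp add: hgroup_concrete intertwined_subspace)
      (simp add: concrete_module_def intertwined_right distrib_left distrib_right mult.assoc)
next
  let ?M = "concrete_module (\<M> H)"
  show "\<forall>X. (\<forall>k::nat. X k \<in> hcarrier ?M) \<and>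
      (\<forall>e>0. \<exists>K. \<forall>k\<ge>K. \<forall>l\<ge>K. hnorm ?M (hminus ?M (X k) (X l)) < e) \<longrightarrow>
      (\<exists>x\<in>hcarrier ?M. (\<lambda>k. hnorm ?M (hminus ?M (X k) x)) \<longlonglongrightarrow> 0)"
  proof (intro allI impI, elim conjE)
    fix X :: "nat \<Rightarrow> 'f"
    assume X: "\<forall>k. X k \<in> hcarrier ?M"
      and "\<forall>e>0. \<exists>K. \<forall>k\<ge>K. \<forall>l\<ge>K. hnorm ?M (hminus ?M (X k) (X l)) < e"
    \<comment> \<open>By the C*-identity the module norm is the norm of the algebra. The limit is
      found there, and closedness puts it back into the module.\<close>
    then have "Cauchy X" by (simp add: hnorm_concrete hminus_concrete Cauchy_def dist_norm)
    then obtain x where x: "X \<longlonglongrightarrow> x" using Cauchy_convergent convergent_def by blast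
    have "x \<in> \<M> H"
      using X by (intro closed_sequentially[OF intertwined_closed _ x]) (simp add: concrete_module_def)
    moreover have "(\<lambda>k. norm (X k - x)) \<longlonglongrightarrow> 0"
      using x by (simp add: LIM_zero tendsto_norm_zero)
    ultimately show "\<exists>x\<in>hcarrier ?M. (\<lambda>k. hnorm ?M (hminus ?M (X k) x)) \<longlonglongrightarrow> 0"
      unfolding hnorm_concrete hminus_concrete by (auto simp: concrete_module_def)
  qed
qed (use intertwined_inner[OF assms] in
    \<open>auto simp: concrete_module_def adj_mult adj_adj distrib_left mult.assoc\<close>)

lemma hilbert_bimodule_intertwined:
  assumes "inv_ahs \<alpha> H"
  shows "hilbert_bimodule \<Z> (concrete_module (\<M> H))"
  unfolding hilbert_bimodule_def
  using hilbert_module_intertwined[OF assms] intertwined_left[OF assms]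
    intertwined_right[of _ "\<rho> H"] cvec.subspace_add[OF intertwined_subspace[of "\<rho> H"]]
  by (simp add: concrete_module_def right_linear_maps_def distrib_left distrib_right mult.assoc
      mult_cscale_left mult_cscale_right adj_mult)

lemma module_onb_concrete_iff:
  "module_onb \<Z> (concrete_module (\<M> H)) n e \<longleftrightarrow>
    (\<forall>i<n. e i \<in> \<M> H) \<and> orthonormal_on {..<n} e \<and>
    (\<forall>x\<in>\<M> H. \<exists>c. (\<forall>i<n. c i \<in> \<Z>) \<and> x = (\<Sum>i<n. e i * c i))"
proof -
  have "finprod (hgroup (concrete_module (\<M> H))) (\<lambda>i. e i * c i) {..<n} = (\<Sum>i<n. e i * c i)"
    if "\<forall>i<n. e i \<in> \<M> H" "\<forall>i<n. c i \<in> \<Z>" for c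
    using that by (intro finprod_concrete intertwined_subspace) (auto intro: intertwined_right)
  moreover have "hcarrier (concrete_module (\<M> H)) = \<M> H"
    "hinner (concrete_module (\<M> H)) x y = x\<^sup>\<star> * y" "hsmul (concrete_module (\<M> H)) x y = x * y"
    for x y by (simp_all add: concrete_module_def)
  ultimately show ?thesis
    unfolding module_onb_def orthonormal_on_def
    by (simp add: Ball_def split del: if_split cong: conj_cong)
qed

text \<open>The members of e lie in \<open>\<M> H\<close> but possibly outside H, so
  \<open>orthonormal_basis_support\<close> does not apply. Instead, a Hilbert space basis consists
  of right combinations of the \<open>e i\<close>, each of which is fixed by the support of
  e.\<close>

lemma module_onb_support:
  assumes "inv_ahs \<alpha> H" "module_onb \<Z> (assoc_module \<alpha> H) n e"
  shows "support {..<n} e = 1"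
proof -
  obtain m :: nat and \<Phi> where \<Phi>: "support {..<m} \<Phi> = 1" "\<And>i. i \<in> {..<m} \<Longrightarrow> \<Phi> i \<in> H"
    using inv_ahsE[OF assms(1)] by metis
  have e: "orthonormal_on {..<n} e" "\<forall>x\<in>\<M> H. \<exists>c. x = (\<Sum>i<n. e i * c i)"
    using assms by (auto simp: assoc_module_eq module_onb_concrete_iff)
  show ?thesis
  proof (rule support_eq_one_if[OF \<Phi>(1)])
    fix j assume "j \<in> {..<m}"
    then obtain c where "\<Phi> j = (\<Sum>i<n. e i * c i)"
      using \<Phi>(2) hilbert_space_intertwined[OF assms(1)] e(2) by blast
    moreover have "support {..<n} e * e i = e i" if "i < n" for i
      using sandwich_mult[OF e(1), of i 1] that by (simp add: sandwich_one)
    ultimately show "support {..<n} e * \<Phi> j = \<Phi> j"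
      by (simp add: sum_distrib_left flip: mult.assoc)
  qed
qed

lemma free_hilbert_bimodule_assoc:
  assumes "inv_ahs \<alpha> H"
  shows "free_hilbert_bimodule \<Z> (assoc_module \<alpha> H)"
proof -
  obtain n :: nat and \<Phi> where \<Phi>: "orthonormal_on {..<n} \<Phi>" "support {..<n} \<Phi> = 1"
    "\<And>i. i \<in> {..<n} \<Longrightarrow> \<Phi> i \<in> \<M> H"
    using inv_ahsE[OF assms] hilbert_space_intertwined[OF assms] by (metis subsetD)
  have "module_onb \<Z> (concrete_module (\<M> H)) n \<Phi>"
    unfolding module_onb_concrete_iff
  proof (intro conjI ballI)
    fix x assume "x \<in> \<M> H"
    then show "\<exists>c. (\<forall>i<n. c i \<in> \<Z>) \<and> x = (\<Sum>i<n. \<Phi> i * c i)"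
      using \<Phi>(3) expand_if_support_one[OF \<Phi>(2), of x] intertwined_inner[OF assms]
      by (intro exI[of _ "\<lambda>i. (\<Phi> i)\<^sup>\<star> * x"]) simp
  qed (use \<Phi> in auto)
  then show ?thesis
    using hilbert_bimodule_intertwined[OF assms] assoc_module_eq[OF assms]
    by (auto simp: free_hilbert_bimodule_def)
qed

section \<open>The isomorphism of categories\<close>

lemma Hom_module_cat_iff:
  assumes "inv_ahs \<alpha> H1" "inv_ahs \<alpha> H2"
  shows "T \<in> Hom (module_cat \<alpha>) (assoc_module \<alpha> H1) (assoc_module \<alpha> H2) \<longleftrightarrow>
    T \<in> \<M> H1 \<rightarrow>\<^sub>E \<M> H2 \<and> (\<forall>x\<in>\<M> H1. \<forall>y\<in>\<M> H1. T (x + y) = T x + T y) \<and>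
    (\<forall>x\<in>\<M> H1. \<forall>z\<in>\<Z>. T (x * z) = T x * z) \<and> (\<forall>g. \<forall>x\<in>\<M> H1. T (\<alpha> g x) = \<alpha> g (T x))"
  using assms by (simp add: module_cat_def right_linear_maps_def assoc_module_eq concrete_module_def)

lemma Hom_endo_cat_iff:
  "X \<in> Hom (endo_cat \<alpha>) \<sigma> \<tau> \<longleftrightarrow> X \<in> \<A> \<and> (\<forall>a\<in>\<A>. X * \<sigma> a = \<tau> a * X)"
  by (simp add: endo_cat_def)

lemma category_endo_cat: "category (endo_cat \<alpha>)"
proof -
  have "Y * X * \<sigma> a = \<upsilon> a * (Y * X)"
    if "X * \<sigma> a = \<tau> a * X" "Y * \<tau> a = \<upsilon> a * Y" for X Y a :: 'f and \<sigma> \<tau> \<upsilon> :: "'f \<Rightarrow> 'f"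
    using that by (metis mult.assoc)
  then show ?thesis
    by (auto simp: category_def endo_cat_def fixed_one fixed_mult mult.assoc)
qed

lemma subcategory_module_cat: "subcategory (module_cat \<alpha>) (free_bimodule_cat \<Z>)"
proof -
  have "category (module_cat \<alpha>)"
    unfolding category_def
  proof (intro conjI ballI)
    fix M assume "M \<in> Obj (module_cat \<alpha>)"
    then obtain H where "inv_ahs \<alpha> H" "M = assoc_module \<alpha> H" by (auto simp: module_cat_def)
    then show "Ident (module_cat \<alpha>) M \<in> Hom (module_cat \<alpha>) M M"
      using cvec.subspace_add[OF intertwined_subspace, of _ "\<rho> H"] intertwined_right[of _ "\<rho> H"]
        intertwined_alpha[of H]
      by (simp add: Hom_module_cat_iff) (simp add: module_cat_def hcarrier_assoc)
  next
    fix M1 M2 M3 S T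
    assume "M1 \<in> Obj (module_cat \<alpha>)" "M2 \<in> Obj (module_cat \<alpha>)" "M3 \<in> Obj (module_cat \<alpha>)"
    then obtain H1 H2 H3 where H: "inv_ahs \<alpha> H1" "inv_ahs \<alpha> H2" "inv_ahs \<alpha> H3"
      "M1 = assoc_module \<alpha> H1" "M2 = assoc_module \<alpha> H2" "M3 = assoc_module \<alpha> H3"
      by (auto simp: module_cat_def)
    assume "S \<in> Hom (module_cat \<alpha>) M1 M2" "T \<in> Hom (module_cat \<alpha>) M2 M3"
    then show "Comp (module_cat \<alpha>) M1 M2 M3 T S \<in> Hom (module_cat \<alpha>) M1 M3"
      using H cvec.subspace_add[OF intertwined_subspace, of _ "\<rho> H1"]
        intertwined_right[of _ "\<rho> H1"] intertwined_alpha[of H1]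
      by (simp add: Hom_module_cat_iff)
        (auto simp: module_cat_def hcarrier_assoc compose_def PiE_iff)
  qed (auto simp: module_cat_def right_linear_maps_def compose_def PiE_iff extensional_def
      fun_eq_iff)
  then show ?thesis
    unfolding subcategory_def using category_free_bimodule_cat[of \<Z>]
    by (auto simp: module_cat_def free_bimodule_cat_def free_hilbert_bimodule_assoc)
qed

text \<open>A description of the arrow map without bases: functoriality is checked on module
  elements, and the matrix formula becomes a statement about all pairs of bases.\<close>

definition intertwiner :: "('f, 'f) hmod \<Rightarrow> ('f, 'f) hmod \<Rightarrow> ('f \<Rightarrow> 'f) \<Rightarrow> 'f" where
  "intertwiner M N T = (THE X. \<forall>x\<in>hcarrier M. X * x = T x)"

lemma cancel_intertwined:
  assumes "inv_ahs \<alpha> H" "\<And>x. x \<in> \<M> H \<Longrightarrow> X * x = Y * x"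
  shows "X = Y"
proof -
  obtain n :: nat and \<Phi> where \<Phi>: "support {..<n} \<Phi> = 1" "\<And>i. i \<in> {..<n} \<Longrightarrow> \<Phi> i \<in> \<M> H"
    using inv_ahsE[OF assms(1)] hilbert_space_intertwined[OF assms(1)] by (metis subsetD)
  show ?thesis by (rule cancel_if_support_one[OF \<Phi>(1)]) (rule assms(2)[OF \<Phi>(2)])
qed

lemma intertwiner_eqI:
  assumes "inv_ahs \<alpha> H" "\<And>x. x \<in> \<M> H \<Longrightarrow> X * x = T x"
  shows "intertwiner (assoc_module \<alpha> H) N T = X"
  unfolding intertwiner_def hcarrier_assoc[OF assms(1)]
proof (rule the_equality)
  fix Y assume "\<forall>x\<in>\<M> H. Y * x = T x"
  then show "Y = X" by (metis cancel_intertwined[OF assms(1)] assms(2))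
qed (use assms in simp)

text \<open>The coefficients \<open>(\<Phi> i)\<^sup>\<star> * x\<close> are central, so right
  linearity moves T onto the \<open>\<Phi> i\<close>. With \<open>\<Phi>\<close> taken from
  \<open>\<M> H1\<close>, this covers Hilbert space bases and module bases alike.\<close>

lemma sum_adj_implements_Hom:
  assumes "inv_ahs \<alpha> H1" "inv_ahs \<alpha> H2"
    and T: "T \<in> Hom (module_cat \<alpha>) (assoc_module \<alpha> H1) (assoc_module \<alpha> H2)"
    and \<Phi>: "\<And>i. i \<in> I \<Longrightarrow> \<Phi> i \<in> \<M> H1" "support I \<Phi> = 1" "finite I"
    and x: "x \<in> \<M> H1"
  shows "(\<Sum>i\<in>I. T (\<Phi> i) * (\<Phi> i)\<^sup>\<star>) * x = T x"
proof -
  note T = T[unfolded Hom_module_cat_iff[OF assms(1,2)]]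
  have zero: "0 \<in> \<M> H1" by (rule cvec.subspace_0[OF intertwined_subspace])
  \<comment> \<open>Right linearity at the scalar 0 gives the empty case of the sum rule
    below.\<close>
  then have "T (0 * 0) = T 0 * 0" using T center_zero by blast
  then have T0: "T 0 = 0" by simp
  have sum: "T (sum f J) = (\<Sum>j\<in>J. T (f j))" if "finite J" "\<And>j. j \<in> J \<Longrightarrow> f j \<in> \<M> H1"
    for f :: "'b \<Rightarrow> 'f" and J
    using that
  proof (induction J rule: finite_induct)
    case (insert j J)
    then have "sum f J \<in> \<M> H1" by (intro cvec.subspace_sum[OF intertwined_subspace]) auto
    then show ?case using insert T by auto
  qed (simp add: T0)
  have c: "(\<Phi> i)\<^sup>\<star> * x \<in> \<Z>" if "i \<in> I" for i
    using intertwined_inner[OF assms(1) \<Phi>(1) x] that by blast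
  have "T x = T (\<Sum>i\<in>I. \<Phi> i * ((\<Phi> i)\<^sup>\<star> * x))"
    using expand_if_support_one[OF \<Phi>(2), of x] by simp
  also have "\<dots> = (\<Sum>i\<in>I. T (\<Phi> i * ((\<Phi> i)\<^sup>\<star> * x)))"
    using \<Phi>(1,3) c by (intro sum) (auto intro: intertwined_right)
  also have "\<dots> = (\<Sum>i\<in>I. T (\<Phi> i) * ((\<Phi> i)\<^sup>\<star> * x))"
    using T \<Phi>(1) c by (intro sum.cong refl) blast
  finally show ?thesis by (simp add: sum_distrib_right mult.assoc)
qed

lemma intertwiner_mult:
  assumes "inv_ahs \<alpha> H1" "inv_ahs \<alpha> H2"
    and "T \<in> Hom (module_cat \<alpha>) (assoc_module \<alpha> H1) (assoc_module \<alpha> H2)" "x \<in> \<M> H1"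
  shows "intertwiner (assoc_module \<alpha> H1) (assoc_module \<alpha> H2) T * x = T x"
proof -
  obtain n :: nat and \<Phi> where \<Phi>: "support {..<n} \<Phi> = 1" "\<And>i. i \<in> {..<n} \<Longrightarrow> \<Phi> i \<in> \<M> H1"
    using inv_ahsE[OF assms(1)] hilbert_space_intertwined[OF assms(1)] by (metis subsetD)
  note * = sum_adj_implements_Hom[OF assms(1-3) \<Phi>(2,1) finite_lessThan]
  show ?thesis using intertwiner_eqI[OF assms(1) *] *[OF _ assms(4)] by simp
qed

text \<open>The entries are \<open>(\<Psi> j)\<^sup>\<star> * T (\<Phi> k)\<close>, so summing over
  j produces the support of \<open>\<Psi>\<close>, which is 1.\<close>

lemma intertwiner_formula:
  assumes "inv_ahs \<alpha> H1" "inv_ahs \<alpha> H2"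
    and "T \<in> Hom (module_cat \<alpha>) (assoc_module \<alpha> H1) (assoc_module \<alpha> H2)"
    and "module_onb \<Z> (assoc_module \<alpha> H2) m \<Psi>" "module_onb \<Z> (assoc_module \<alpha> H1) n \<Phi>"
  shows "intertwiner (assoc_module \<alpha> H1) (assoc_module \<alpha> H2) T =
    (\<Sum>j<m. \<Sum>k<n. \<Psi> j * operator_matrix (assoc_module \<alpha> H2) \<Psi> \<Phi> T j k * (\<Phi> k)\<^sup>\<star>)"
proof -
  have "operator_matrix (assoc_module \<alpha> H2) \<Psi> \<Phi> T j k = (\<Psi> j)\<^sup>\<star> * T (\<Phi> k)" for j k
    by (simp add: operator_matrix_def assoc_module_def concrete_module_def)
  then have "(\<Sum>j<m. \<Sum>k<n. \<Psi> j * operator_matrix (assoc_module \<alpha> H2) \<Psi> \<Phi> T j k * (\<Phi> k)\<^sup>\<star>)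
      = support {..<m} \<Psi> * (\<Sum>k<n. T (\<Phi> k) * (\<Phi> k)\<^sup>\<star>)"
    by (simp add: support_def sum_product mult.assoc)
  also have "\<dots> = (\<Sum>k<n. T (\<Phi> k) * (\<Phi> k)\<^sup>\<star>)"
    using module_onb_support[OF assms(2,4)] by simp
  also have "\<dots> = intertwiner (assoc_module \<alpha> H1) (assoc_module \<alpha> H2) T"
    using assms(5) module_onb_support[OF assms(1,5)]
    by (intro intertwiner_eqI[symmetric] sum_adj_implements_Hom[OF assms(1-3)] assms(1))
      (auto simp: assoc_module_eq[OF assms(1)] module_onb_concrete_iff)
  finally show ?thesis by simp
qed

lemma intertwiner_in_Hom:
  assumes "inv_ahs \<alpha> H1" "inv_ahs \<alpha> H2"
    and T: "T \<in> Hom (module_cat \<alpha>) (assoc_module \<alpha> H1) (assoc_module \<alpha> H2)"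
  shows "intertwiner (assoc_module \<alpha> H1) (assoc_module \<alpha> H2) T
    \<in> Hom (endo_cat \<alpha>) (\<rho> H1) (\<rho> H2)"
proof -
  define X where "X = intertwiner (assoc_module \<alpha> H1) (assoc_module \<alpha> H2) T"
  have X: "X * x = T x" if "x \<in> \<M> H1" for x
    unfolding X_def using that by (rule intertwiner_mult[OF assms])
  note T = T[unfolded Hom_module_cat_iff[OF assms(1,2)]]
  \<comment> \<open>Writing x as \<open>\<alpha> g (\<alpha> (- g) x)\<close> and using that T
    commutes with the action shows that both elements act alike on the module.\<close>
  have "\<alpha> g X = X" for g
  proof (rule cancel_intertwined[OF assms(1)])
    fix x assume x: "x \<in> \<M> H1"
    then have y: "\<alpha> (- g) x \<in> \<M> H1" by (rule intertwined_alpha[OF assms(1)])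
    have "\<alpha> g X * x = \<alpha> g (X * \<alpha> (- g) x)" by (simp add: alpha_mult)
    also have "\<dots> = \<alpha> g (T (\<alpha> (- g) x))" using X[OF y] by simp
    also have "\<dots> = T (\<alpha> g (\<alpha> (- g) x))" using T y by metis
    finally show "\<alpha> g X * x = X * x" using X[OF x] by simp
  qed
  moreover have "X * \<rho> H1 a = \<rho> H2 a * X" if a: "a \<in> \<A>" for a
  proof (rule cancel_intertwined[OF assms(1)])
    fix x assume x: "x \<in> \<M> H1"
    have "X * \<rho> H1 a * x = T x * a"
      using intertwined_mult[OF x a] X[OF x] by (metis mult.assoc)
    also have "\<dots> = \<rho> H2 a * T x"
      using T x by (intro intertwined_mult a) auto
    finally show "X * \<rho> H1 a * x = \<rho> H2 a * X * x" using X[OF x] by (simp add: mult.assoc)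
  qed
  ultimately show ?thesis
    by (simp add: Hom_endo_cat_iff X_def[symmetric] fixed_algebra_def)
qed

lemma left_mult_in_Hom:
  assumes "inv_ahs \<alpha> H1" "inv_ahs \<alpha> H2" "X \<in> Hom (endo_cat \<alpha>) (\<rho> H1) (\<rho> H2)"
  shows "(\<lambda>x\<in>\<M> H1. X * x) \<in> Hom (module_cat \<alpha>) (assoc_module \<alpha> H1) (assoc_module \<alpha> H2)"
proof -
  have X: "X \<in> \<A>" "\<And>a. a \<in> \<A> \<Longrightarrow> X * \<rho> H1 a = \<rho> H2 a * X"
    using assms(3) by (auto simp: Hom_endo_cat_iff)
  have "X * x \<in> \<M> H2" if "x \<in> \<M> H1" for x
    unfolding intertwined_def mem_Collect_eq
    using that X(2) by (metis mult.assoc intertwined_mult)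
  then show ?thesis
    using assms(1,2) cvec.subspace_add[OF intertwined_subspace, of _ "\<rho> H1"]
      intertwined_right[of _ "\<rho> H1"] intertwined_alpha[OF assms(1)]
    by (simp add: Hom_module_cat_iff distrib_left mult.assoc alpha_mult alpha_fixed[OF X(1)])
qed

lemma bij_intertwiner:
  assumes "inv_ahs \<alpha> H1" "inv_ahs \<alpha> H2"
  shows "bij_betw (intertwiner (assoc_module \<alpha> H1) (assoc_module \<alpha> H2))
    (Hom (module_cat \<alpha>) (assoc_module \<alpha> H1) (assoc_module \<alpha> H2))
    (Hom (endo_cat \<alpha>) (\<rho> H1) (\<rho> H2))"
proof (rule bij_betw_byWitness[where f' = "\<lambda>X. \<lambda>x\<in>\<M> H1. X * x"])
  show "\<forall>T\<in>Hom (module_cat \<alpha>) (assoc_module \<alpha> H1) (assoc_module \<alpha> H2).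
      (\<lambda>x\<in>\<M> H1. intertwiner (assoc_module \<alpha> H1) (assoc_module \<alpha> H2) T * x) = T"
  proof
    fix T assume T: "T \<in> Hom (module_cat \<alpha>) (assoc_module \<alpha> H1) (assoc_module \<alpha> H2)"
    show "(\<lambda>x\<in>\<M> H1. intertwiner (assoc_module \<alpha> H1) (assoc_module \<alpha> H2) T * x) = T"
      using T assms
      by (intro extensionalityI[of _ "\<M> H1"]) (simp_all add: intertwiner_mult Hom_module_cat_iff PiE_iff)
  qed
  show "\<forall>X\<in>Hom (endo_cat \<alpha>) (\<rho> H1) (\<rho> H2).
      intertwiner (assoc_module \<alpha> H1) (assoc_module \<alpha> H2) (\<lambda>x\<in>\<M> H1. X * x) = X"
    using assms by (auto intro!: intertwiner_eqI)
qed (use assms intertwiner_in_Hom left_mult_in_Hom in auto)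

text \<open>Many H may yield M; by \<open>assoc_module_eq_iff\<close> the endomorphism is the same
  for all of them.\<close>

definition endo_of :: "('f, 'f) hmod \<Rightarrow> 'f \<Rightarrow> 'f" where
  "endo_of M = \<rho> (SOME H. inv_ahs \<alpha> H \<and> assoc_module \<alpha> H = M)"

lemma endo_of_assoc:
  assumes "inv_ahs \<alpha> H"
  shows "endo_of (assoc_module \<alpha> H) = \<rho> H"
proof -
  define K where "K = (SOME K. inv_ahs \<alpha> K \<and> assoc_module \<alpha> K = assoc_module \<alpha> H)"
  have "inv_ahs \<alpha> K \<and> assoc_module \<alpha> K = assoc_module \<alpha> H"
    unfolding K_def by (rule someI[of _ H]) (simp add: assms)
  then show ?thesis
    using assoc_module_eq_iff[of K H] assms by (simp add: endo_of_def K_def[symmetric])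
qed

lemma cat_isomorphism_intertwiner:
  "cat_isomorphism (module_cat \<alpha>) (endo_cat \<alpha>) endo_of intertwiner"
proof -
  let ?\<H> = "{H. inv_ahs \<alpha> H}"
  have obj: "Obj (module_cat \<alpha>) = assoc_module \<alpha> ` ?\<H>" "Obj (endo_cat \<alpha>) = \<rho> ` ?\<H>"
    by (simp_all add: module_cat_def endo_cat_def)
  have "bij_betw endo_of (Obj (module_cat \<alpha>)) (Obj (endo_cat \<alpha>))"
    by (auto simp: bij_betw_def inj_on_def obj endo_of_assoc assoc_module_eq_iff image_image
        intro!: image_cong)
  moreover have "cat_functor (module_cat \<alpha>) (endo_cat \<alpha>) endo_of intertwiner"
    unfolding cat_functor_def
  proof (intro conjI ballI)
    fix M assume "M \<in> Obj (module_cat \<alpha>)"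
    then obtain H where H: "inv_ahs \<alpha> H" "M = assoc_module \<alpha> H" by (auto simp: obj)
    then show "endo_of M \<in> Obj (endo_cat \<alpha>)" by (auto simp: obj endo_of_assoc)
    show "intertwiner M M (Ident (module_cat \<alpha>) M) = Ident (endo_cat \<alpha>) (endo_of M)"
      using H by (auto simp: module_cat_def endo_cat_def hcarrier_assoc intro!: intertwiner_eqI)
  next
    fix M N T assume "M \<in> Obj (module_cat \<alpha>)" "N \<in> Obj (module_cat \<alpha>)"
      "T \<in> Hom (module_cat \<alpha>) M N"
    then show "intertwiner M N T \<in> Hom (endo_cat \<alpha>) (endo_of M) (endo_of N)"
      by (auto simp: obj endo_of_assoc intertwiner_in_Hom)
  next
    fix M1 M2 M3 S T
    assume "M1 \<in> Obj (module_cat \<alpha>)" "M2 \<in> Obj (module_cat \<alpha>)" "M3 \<in> Obj (module_cat \<alpha>)"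
    then obtain H1 H2 H3 where H: "inv_ahs \<alpha> H1" "inv_ahs \<alpha> H2" "inv_ahs \<alpha> H3"
      "M1 = assoc_module \<alpha> H1" "M2 = assoc_module \<alpha> H2" "M3 = assoc_module \<alpha> H3"
      by (auto simp: obj)
    assume ST: "S \<in> Hom (module_cat \<alpha>) M1 M2" "T \<in> Hom (module_cat \<alpha>) M2 M3"
    \<comment> \<open>The product implements the composite map on the first module, and this
      property singles out one element.\<close>
    have "intertwiner M1 M3 (Comp (module_cat \<alpha>) M1 M2 M3 T S)
        = intertwiner M2 M3 T * intertwiner M1 M2 S"
      unfolding H(4)
    proof (rule intertwiner_eqI[OF H(1)])
      fix x assume x: "x \<in> \<M> H1"
      have "intertwiner M2 M3 T * (intertwiner (assoc_module \<alpha> H1) M2 S * x) = T (S x)"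
      proof -
        have "S x \<in> \<M> H2" using ST(1) x H by (auto simp: Hom_module_cat_iff)
        then show ?thesis using ST x H by (simp add: intertwiner_mult)
      qed
      then show "intertwiner M2 M3 T * intertwiner (assoc_module \<alpha> H1) M2 S * x
          = Comp (module_cat \<alpha>) (assoc_module \<alpha> H1) M2 M3 T S x"
        using x H by (simp add: mult.assoc module_cat_def hcarrier_assoc compose_def)
    qed
    then show "intertwiner M1 M3 (Comp (module_cat \<alpha>) M1 M2 M3 T S)
        = Comp (endo_cat \<alpha>) (endo_of M1) (endo_of M2) (endo_of M3)
            (intertwiner M2 M3 T) (intertwiner M1 M2 S)"
      by (simp add: endo_cat_def)
  qed
  moreover have "category (module_cat \<alpha>)"
    using subcategory_module_cat by (simp add: subcategory_def)
  ultimately show ?thesis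
    unfolding cat_isomorphism_def
    by (auto simp: category_endo_cat obj endo_of_assoc bij_intertwiner)
qed

section \<open>Sums and products of objects\<close>

lemma inv_ahs_span:
  assumes "orthonormal_on I \<Phi>" "support I \<Phi> = 1"
    and "\<And>g i. i \<in> I \<Longrightarrow> \<alpha> g (\<Phi> i) \<in> cvec.span (\<Phi> ` I)"
  shows "inv_ahs \<alpha> (cvec.span (\<Phi> ` I))"
    and "\<And>a. a \<in> \<A> \<Longrightarrow> \<rho> (cvec.span (\<Phi> ` I)) a = sandwich I \<Phi> a"
proof -
  have H: "algebraic_hilbert_space (cvec.span (\<Phi> ` I))"
    by (rule algebraic_hilbert_space_span[OF assms(1,2)])
  have "cvec.span (\<Phi> ` I) \<subseteq> {x. \<alpha> g x \<in> cvec.span (\<Phi> ` I)}" for g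
  proof (rule cvec.span_minimal)
    show "cvec.subspace {x. \<alpha> g x \<in> cvec.span (\<Phi> ` I)}"
      by (auto simp: cvec.subspace_def alpha_add alpha_cscale
          intro: cvec.span_zero cvec.span_add cvec.span_scale)
  qed (use assms(3) in auto)
  then show "inv_ahs \<alpha> (cvec.span (\<Phi> ` I))"
    using H by (auto simp: inv_ahs_def invariant_def)
  show "\<And>a. a \<in> \<A> \<Longrightarrow> \<rho> (cvec.span (\<Phi> ` I)) a = sandwich I \<Phi> a"
    by (rule canonical_endo_eq[OF H refl assms(1)])
qed

text \<open>Leaves two tasks for each correspondence: find one K with endomorphism
  \<open>\<sigma>\<close>, and compute \<open>intertwined \<sigma>\<close>.\<close>

lemma object_correspondence:
  assumes "inv_ahs \<alpha> K" "\<rho> K = \<sigma>" "intertwined \<sigma> = S"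
  shows "\<sigma> \<in> Obj (endo_cat \<alpha>)" "concrete_module S \<in> Obj (module_cat \<alpha>)"
    and "\<forall>H. inv_ahs \<alpha> H \<longrightarrow> (\<rho> H = \<sigma> \<longleftrightarrow> assoc_module \<alpha> H = concrete_module S)"
proof -
  have K: "assoc_module \<alpha> K = concrete_module S" using assms by (simp add: assoc_module_eq)
  show "\<sigma> \<in> Obj (endo_cat \<alpha>)" using assms(1,2) by (auto simp: endo_cat_def)
  show "concrete_module S \<in> Obj (module_cat \<alpha>)"
    using assms(1) K by (force simp: module_cat_def)
  show "\<forall>H. inv_ahs \<alpha> H \<longrightarrow> (\<rho> H = \<sigma> \<longleftrightarrow> assoc_module \<alpha> H = concrete_module S)"
    using assms(1,2) K assoc_module_eq_iff by metis
qed

lemma inv_ahs_alpha: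
  assumes "inv_ahs \<alpha> H" "x \<in> H"
  shows "\<alpha> g x \<in> H"
  using assms by (auto simp: inv_ahs_def invariant_def)

lemma endo_sum:
  assumes "inv_ahs \<alpha> H1" "inv_ahs \<alpha> H2" "V \<in> \<A>" "W \<in> \<A>"
    and VW: "V\<^sup>\<star> * V = 1" "W\<^sup>\<star> * W = 1" "V * V\<^sup>\<star> + W * W\<^sup>\<star> = 1"
  defines "\<sigma> \<equiv> \<lambda>a\<in>\<A>. V * \<rho> H1 a * V\<^sup>\<star> + W * \<rho> H2 a * W\<^sup>\<star>"
  shows "\<exists>K. inv_ahs \<alpha> K \<and> \<rho> K = \<sigma>"
    and "intertwined \<sigma> = {V * x + W * y |x y. x \<in> \<M> H1 \<and> y \<in> \<M> H2}"
proof -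
  \<comment> \<open>The range relation forces
    \<open>V\<^sup>\<star> * W * W\<^sup>\<star> = 0\<close>; as W is an isometry, the two ranges
    are orthogonal.\<close>
  have "V\<^sup>\<star> = V\<^sup>\<star> * (V * V\<^sup>\<star> + W * W\<^sup>\<star>)" using VW(3) by simp
  also have "\<dots> = V\<^sup>\<star> + V\<^sup>\<star> * W * W\<^sup>\<star>"
    using VW(1) by (simp add: distrib_left flip: mult.assoc)
  finally have "V\<^sup>\<star> * W * W\<^sup>\<star> = 0" by simp
  then have VsW: "V\<^sup>\<star> * W = 0" using VW(2) by (metis mult.assoc mult.right_neutral mult_zero_left)
  then have WsV: "W\<^sup>\<star> * V = 0" by (metis adj_adj adj_mult adj_zero)
  have cancel: "V\<^sup>\<star> * (V * x) = x" "W\<^sup>\<star> * (W * x) = x" "V\<^sup>\<star> * (W * x) = 0" "W\<^sup>\<star> * (V * x) = 0"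
    for x using VW(1,2) VsW WsV by (simp_all flip: mult.assoc)
  obtain n :: nat and \<Phi> where \<Phi>: "orthonormal_on {..<n} \<Phi>" "support {..<n} \<Phi> = 1"
    "H1 = cvec.span (\<Phi> ` {..<n})" "\<And>i. i \<in> {..<n} \<Longrightarrow> \<Phi> i \<in> H1"
    "\<And>a. a \<in> \<A> \<Longrightarrow> \<rho> H1 a = sandwich {..<n} \<Phi> a"
    using inv_ahsE[OF assms(1)] by blast
  obtain m :: nat and \<Psi> where \<Psi>: "orthonormal_on {..<m} \<Psi>" "support {..<m} \<Psi> = 1"
    "H2 = cvec.span (\<Psi> ` {..<m})" "\<And>i. i \<in> {..<m} \<Longrightarrow> \<Psi> i \<in> H2"
    "\<And>a. a \<in> \<A> \<Longrightarrow> \<rho> H2 a = sandwich {..<m} \<Psi> a"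
    using inv_ahsE[OF assms(2)] by blast
  define I where "I = {..<n} <+> {..<m}"
  define \<Theta> where "\<Theta> = case_sum (\<lambda>i. V * \<Phi> i) (\<lambda>j. W * \<Psi> j)"
  have "(\<Phi> i)\<^sup>\<star> * \<Phi> j = (if i = j then 1 else 0)" if "i < n" "j < n" for i j
    using \<Phi>(1) that by (simp add: orthonormal_on_def)
  moreover have "(\<Psi> i)\<^sup>\<star> * \<Psi> j = (if i = j then 1 else 0)" if "i < m" "j < m" for i j
    using \<Psi>(1) that by (simp add: orthonormal_on_def)
  ultimately have \<Theta>: "orthonormal_on I \<Theta>"
    by (auto simp: orthonormal_on_def I_def \<Theta>_def adj_mult mult.assoc cancel split: if_splits)
  have sandwich: "sandwich I \<Theta> a = V * sandwich {..<n} \<Phi> a * V\<^sup>\<star> + W * sandwich {..<m} \<Psi> a * W\<^sup>\<star>" for a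
    by (simp add: sandwich_def I_def \<Theta>_def sum.Plus adj_mult sum_distrib_left sum_distrib_right
        mult.assoc)
  have supp: "support I \<Theta> = 1"
    using sandwich[of 1] \<Phi>(2) \<Psi>(2) VW(3) by (simp add: sandwich_one)
  have "V * x \<in> cvec.span (\<Theta> ` I)" if "x \<in> H1" for x
  proof -
    have "cvec.span (\<Phi> ` {..<n}) \<subseteq> {x. V * x \<in> cvec.span (\<Theta> ` I)}"
    proof (rule cvec.span_minimal)
      have "V * \<Phi> i = \<Theta> (Inl i)" for i by (simp add: \<Theta>_def)
      then show "\<Phi> ` {..<n} \<subseteq> {x. V * x \<in> cvec.span (\<Theta> ` I)}"
        by (auto simp: I_def intro!: cvec.span_base)
    qed (auto simp: cvec.subspace_def distrib_left mult_cscale_right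
        intro: cvec.span_zero cvec.span_add cvec.span_scale)
    then show ?thesis using that \<Phi>(3) by blast
  qed
  moreover have "W * x \<in> cvec.span (\<Theta> ` I)" if "x \<in> H2" for x
  proof -
    have "cvec.span (\<Psi> ` {..<m}) \<subseteq> {x. W * x \<in> cvec.span (\<Theta> ` I)}"
    proof (rule cvec.span_minimal)
      have "W * \<Psi> i = \<Theta> (Inr i)" for i by (simp add: \<Theta>_def)
      then show "\<Psi> ` {..<m} \<subseteq> {x. W * x \<in> cvec.span (\<Theta> ` I)}"
        by (auto simp: I_def intro!: cvec.span_base)
    qed (auto simp: cvec.subspace_def distrib_left mult_cscale_right
        intro: cvec.span_zero cvec.span_add cvec.span_scale)
    then show ?thesis using that \<Psi>(3) by blast
  qed
  \<comment> \<open>V and W are fixed by the group, which therefore acts only on the vectors of H1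
    and H2.\<close>
  ultimately have inv: "\<alpha> g (\<Theta> i) \<in> cvec.span (\<Theta> ` I)" if "i \<in> I" for g i
    using that \<Phi>(4) \<Psi>(4) inv_ahs_alpha[OF assms(1)] inv_ahs_alpha[OF assms(2)]
    by (auto simp: I_def \<Theta>_def alpha_mult alpha_fixed[OF assms(3)] alpha_fixed[OF assms(4)])
  have K: "inv_ahs \<alpha> (cvec.span (\<Theta> ` I))"
    "\<And>a. a \<in> \<A> \<Longrightarrow> \<rho> (cvec.span (\<Theta> ` I)) a = sandwich I \<Theta> a"
    using inv_ahs_span[OF \<Theta> supp] inv by blast+
  have "\<rho> (cvec.span (\<Theta> ` I)) = \<sigma>"
    by (rule extensionalityI[OF endo_extensional])
      (simp_all add: \<sigma>_def K(2) sandwich \<Phi>(5) \<Psi>(5))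
  with K(1) show "\<exists>K. inv_ahs \<alpha> K \<and> \<rho> K = \<sigma>" by blast
  show "intertwined \<sigma> = {V * x + W * y |x y. x \<in> \<M> H1 \<and> y \<in> \<M> H2}"
  proof (intro subset_antisym subsetI)
    fix x assume x: "x \<in> intertwined \<sigma>"
    \<comment> \<open>The two components of x; the range relation reassembles x from them.\<close>
    have "V\<^sup>\<star> * x \<in> \<M> H1" "W\<^sup>\<star> * x \<in> \<M> H2"
      unfolding intertwined_def
      by (simp_all add: mult.assoc intertwined_mult[OF x])
        (simp_all add: \<sigma>_def distrib_right distrib_left mult.assoc cancel)
    moreover have "x = (V * V\<^sup>\<star> + W * W\<^sup>\<star>) * x" using VW(3) by simp
    then have "x = V * (V\<^sup>\<star> * x) + W * (W\<^sup>\<star> * x)" by (simp add: distrib_right mult.assoc)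
    ultimately show "x \<in> {V * x + W * y |x y. x \<in> \<M> H1 \<and> y \<in> \<M> H2}" by blast
  next
    fix u assume "u \<in> {V * x + W * y |x y. x \<in> \<M> H1 \<and> y \<in> \<M> H2}"
    then obtain x y where "u = V * x + W * y" "x \<in> \<M> H1" "y \<in> \<M> H2" by blast
    then show "u \<in> intertwined \<sigma>"
      by (simp add: intertwined_def \<sigma>_def distrib_right distrib_left mult.assoc cancel)
  qed
qed

lemma endo_compose:
  assumes "inv_ahs \<alpha> H1" "inv_ahs \<alpha> H2"
  defines "\<sigma> \<equiv> compose \<A> (\<rho> H1) (\<rho> H2)"
  shows "\<exists>K. inv_ahs \<alpha> K \<and> \<rho> K = \<sigma>"
    and "intertwined \<sigma> = span_prod (\<M> H1) (\<M> H2)"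
proof -
  have \<sigma>: "\<sigma> a = \<rho> H1 (\<rho> H2 a)" if "a \<in> \<A>" for a
    using that by (simp add: \<sigma>_def compose_def)
  obtain n :: nat and \<Phi> where \<Phi>: "orthonormal_on {..<n} \<Phi>" "support {..<n} \<Phi> = 1"
    "H1 = cvec.span (\<Phi> ` {..<n})" "\<And>i. i \<in> {..<n} \<Longrightarrow> \<Phi> i \<in> H1"
    "\<And>a. a \<in> \<A> \<Longrightarrow> \<rho> H1 a = sandwich {..<n} \<Phi> a"
    using inv_ahsE[OF assms(1)] by blast
  obtain m :: nat and \<Psi> where \<Psi>: "orthonormal_on {..<m} \<Psi>" "support {..<m} \<Psi> = 1"
    "H2 = cvec.span (\<Psi> ` {..<m})" "\<And>i. i \<in> {..<m} \<Longrightarrow> \<Psi> i \<in> H2"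
    "\<And>a. a \<in> \<A> \<Longrightarrow> \<rho> H2 a = sandwich {..<m} \<Psi> a"
    using inv_ahsE[OF assms(2)] by blast
  define I where "I = {..<n} \<times> {..<m}"
  \<comment> \<open>For products of basis vectors the sandwich is the composite of the two
    sandwiches, so full support is inherited.\<close>
  define \<Theta> where "\<Theta> = (\<lambda>(i, j). \<Phi> i * \<Psi> j)"
  have "(\<Phi> i * \<Psi> j)\<^sup>\<star> * (\<Phi> k * \<Psi> l) = (if i = k \<and> j = l then 1 else 0)"
    if "i < n" "k < n" "j < m" "l < m" for i j k l
  proof -
    have "(\<Phi> i * \<Psi> j)\<^sup>\<star> * (\<Phi> k * \<Psi> l) = (\<Psi> j)\<^sup>\<star> * ((\<Phi> i)\<^sup>\<star> * \<Phi> k) * \<Psi> l"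
      by (simp add: adj_mult mult.assoc)
    then show ?thesis using \<Phi>(1) \<Psi>(1) that by (simp add: orthonormal_on_def)
  qed
  then have \<Theta>: "orthonormal_on I \<Theta>"
    by (auto simp: orthonormal_on_def I_def \<Theta>_def)
  have sandwich: "sandwich I \<Theta> a = sandwich {..<n} \<Phi> (sandwich {..<m} \<Psi> a)" for a
    by (simp add: sandwich_def I_def \<Theta>_def adj_mult sum_distrib_left sum_distrib_right
        mult.assoc sum.cartesian_product case_prod_unfold)
  have supp: "support I \<Theta> = 1"
    using sandwich[of 1] \<Phi>(2) \<Psi>(2) by (simp add: sandwich_one)
  have "\<Theta> ` I = {x * y |x y. x \<in> \<Phi> ` {..<n} \<and> y \<in> \<Psi> ` {..<m}}"
    by (auto simp: \<Theta>_def I_def image_iff)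
  then have "span_prod (\<Phi> ` {..<n}) (\<Psi> ` {..<m}) = cvec.span (\<Theta> ` I)"
    by (simp add: span_prod_def)
  then have "x * y \<in> cvec.span (\<Theta> ` I)" if "x \<in> H1" "y \<in> H2" for x y
    using span_times_span that unfolding \<Phi>(3) \<Psi>(3) by blast
  then have inv: "\<alpha> g (\<Theta> i) \<in> cvec.span (\<Theta> ` I)" if "i \<in> I" for g i
    using that \<Phi>(4) \<Psi>(4) inv_ahs_alpha[OF assms(1)] inv_ahs_alpha[OF assms(2)]
    by (auto simp: I_def \<Theta>_def alpha_mult)
  have K: "inv_ahs \<alpha> (cvec.span (\<Theta> ` I))"
    "\<And>a. a \<in> \<A> \<Longrightarrow> \<rho> (cvec.span (\<Theta> ` I)) a = sandwich I \<Theta> a"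
    using inv_ahs_span[OF \<Theta> supp] inv by blast+
  have "\<rho> (cvec.span (\<Theta> ` I)) = \<sigma>"
  proof (rule extensionalityI[OF endo_extensional])
    show "\<sigma> \<in> extensional \<A>" by (simp add: \<sigma>_def compose_def)
    fix a assume a: "a \<in> \<A>"
    show "\<rho> (cvec.span (\<Theta> ` I)) a = \<sigma> a"
      using \<Phi>(5)[OF endo_fixed[OF assms(2) a]] \<Psi>(5)[OF a]
      by (simp add: \<sigma>[OF a] K(2)[OF a] sandwich)
  qed
  with K(1) show "\<exists>K. inv_ahs \<alpha> K \<and> \<rho> K = \<sigma>" by blast
  show "intertwined \<sigma> = span_prod (\<M> H1) (\<M> H2)"
  proof
    show "intertwined \<sigma> \<subseteq> span_prod (\<M> H1) (\<M> H2)"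
    proof
      fix x assume x: "x \<in> intertwined \<sigma>"
      \<comment> \<open>Since \<open>(\<Phi> i)\<^sup>\<star> * \<rho> H1 b = b * (\<Phi>
        i)\<^sup>\<star>\<close>, the choice of b as \<open>\<rho> H2 a\<close> strips the outer
        endomorphism. Expanding x along \<open>\<Phi>\<close> then exhibits it as a sum of
        products.\<close>
      have "(\<Phi> i)\<^sup>\<star> * x \<in> \<M> H2" if i: "i < n" for i
        unfolding intertwined_def mem_Collect_eq
      proof
        fix a assume a: "a \<in> \<A>"
        define b where "b = \<rho> H2 a"
        have b: "b \<in> \<A>" unfolding b_def by (rule endo_fixed[OF assms(2) a])
        have "(\<Phi> i)\<^sup>\<star> * \<rho> H1 b = (\<rho> H1 (b\<^sup>\<star>) * \<Phi> i)\<^sup>\<star>"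
          using endo_adj[OF assms(1) b] by (metis adj_mult adj_adj)
        also have "\<dots> = (\<Phi> i * b\<^sup>\<star>)\<^sup>\<star>"
          using \<Phi>(4) hilbert_space_intertwined[OF assms(1)] i fixed_adj[OF b]
          by (subst intertwined_mult[of "\<Phi> i" "\<rho> H1"]) auto
        finally have "(\<Phi> i)\<^sup>\<star> * \<rho> H1 b = b * (\<Phi> i)\<^sup>\<star>" by (simp add: adj_mult adj_adj)
        then show "(\<Phi> i)\<^sup>\<star> * x * a = \<rho> H2 a * ((\<Phi> i)\<^sup>\<star> * x)"
          using intertwined_mult[OF x a] \<sigma>[OF a] by (metis b_def mult.assoc)
      qed
      then have "(\<Sum>i<n. \<Phi> i * ((\<Phi> i)\<^sup>\<star> * x)) \<in> span_prod (\<M> H1) (\<M> H2)"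
        unfolding span_prod_def using \<Phi>(4) hilbert_space_intertwined[OF assms(1)]
        by (intro cvec.span_sum cvec.span_base) blast
      then show "x \<in> span_prod (\<M> H1) (\<M> H2)"
        using expand_if_support_one[OF \<Phi>(2), of x] by simp
    qed
    have "x * y \<in> intertwined \<sigma>" if "x \<in> \<M> H1" "y \<in> \<M> H2" for x y
      unfolding intertwined_def mem_Collect_eq
    proof
      fix a assume a: "a \<in> \<A>"
      show "x * y * a = \<sigma> a * (x * y)"
        using intertwined_mult[OF that(2) a] intertwined_mult[OF that(1) endo_fixed[OF assms(2) a]]
        by (metis \<sigma>[OF a] mult.assoc)
    qed
    then show "span_prod (\<M> H1) (\<M> H2) \<subseteq> intertwined \<sigma>"
      unfolding span_prod_def by (intro cvec.span_minimal intertwined_subspace) blast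
  qed
qed
end

section \<open>The inner tensor product inside the algebra\<close>

text \<open>The multiplication map from formal tensors to the algebra.\<close>

definition tensor_value :: "('a::cstar_algebra \<times> 'a) list \<Rightarrow> 'a" where
  "tensor_value u = (\<Sum>(x, y)\<leftarrow>u. x * y)"

lemma tensor_value_simps [simp]:
  "tensor_value [] = 0" "tensor_value ((x, y) # u) = x * y + tensor_value u"
  "tensor_value (u @ v) = tensor_value u + tensor_value v"
  by (simp_all add: tensor_value_def)

lemma tensor_value_map_right:
  "tensor_value (map (\<lambda>(x, y). (x, y * z)) u) = tensor_value u * z"
  by (induction u) (auto simp: distrib_right mult.assoc)

lemma tensor_value_map_left:
  "tensor_value (map (\<lambda>(x, y). (z * x, y)) u) = z * tensor_value u"
  by (induction u) (auto simp: distrib_left mult.assoc)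

text \<open>On elementary tensors \<open>y\<^sup>\<star> * (x\<^sup>\<star> * x' * y')\<close>
  equals \<open>(x * y)\<^sup>\<star> * (x' * y')\<close>, so the form is a pullback along
  multiplication.\<close>

lemma tensor_form_concrete:
  "tensor_form (concrete_module S) (concrete_module T) u v
    = (tensor_value u)\<^sup>\<star> * tensor_value (v :: ('a::cstar_algebra \<times> 'a) list)"
proof -
  have "(\<Sum>(x', y')\<leftarrow>v. y\<^sup>\<star> * (x\<^sup>\<star> * x' * y')) = (x * y)\<^sup>\<star> * tensor_value v" for x y :: 'a
    by (induction v) (auto simp: adj_mult distrib_left mult.assoc)
  then show ?thesis
    unfolding tensor_form_def concrete_module_def
    by (induction u) (auto simp: adj_add distrib_right)
qed

text \<open>As \<open>a\<^sup>\<star> * a = 0\<close> forces \<open>a = 0\<close>, dividing by null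
  vectors identifies exactly the formal sums with equal products.\<close>

lemma tensor_class_concrete:
  "tensor_class (concrete_module S) (concrete_module T) u
    = {v \<in> lists (S \<times> T). tensor_value v = tensor_value u}"
proof -
  have "tensor_value (tensor_neg (concrete_module S) (concrete_module T) v) = - tensor_value v" for v
    using tensor_value_map_right[of "- 1" v] by (simp add: tensor_neg_def concrete_module_def)
  then show ?thesis
    unfolding tensor_class_def tensor_form_concrete by (auto simp: concrete_module_def)
qed

text \<open>Scalars are absorbed into the left factors, so the values already form a
  subspace.\<close>

lemma tensor_value_surj:
  assumes "cvec.subspace S" "x \<in> span_prod S T"
  shows "\<exists>u\<in>lists (S \<times> T). tensor_value u = x"
proof -
  let ?V = "tensor_value ` lists (S \<times> T)"
  have "cvec.subspace ?V"
    unfolding cvec.subspace_def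
  proof (intro conjI ballI allI)
    show "0 \<in> ?V" by (rule image_eqI[of _ _ "[]"]) auto
    fix x assume "x \<in> ?V"
    then obtain u where u: "u \<in> lists (S \<times> T)" "x = tensor_value u" by blast
    have "c *\<^sub>C tensor_value u = tensor_value (map (\<lambda>(x, y). (c *\<^sub>C x, y)) u)" for c
      by (induction u) (auto simp: cscale_add_right mult_cscale_left)
    moreover have "map (\<lambda>(x, y). (c *\<^sub>C x, y)) u \<in> lists (S \<times> T)" for c
      using u(1) cvec.subspace_scale[OF assms(1)] by (force simp: in_lists_conv_set)
    ultimately show "c *\<^sub>C x \<in> ?V" for c using u(2) by blast
    fix y assume "y \<in> ?V"
    then obtain v where "v \<in> lists (S \<times> T)" "y = tensor_value v" by blast
    then show "x + y \<in> ?V" using u by (intro image_eqI[of _ _ "u @ v"]) auto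
  qed
  moreover have "x * y \<in> ?V" if "x \<in> S" "y \<in> T" for x y
    using that by (intro image_eqI[of _ _ "[(x, y)]"]) auto
  ultimately have "span_prod S T \<subseteq> ?V"
    unfolding span_prod_def by (intro cvec.span_minimal) auto
  then show ?thesis using assms(2) by blast
qed

context minimal_system begin

lemma inner_tensor_product_intertwined:
  assumes "inv_ahs \<alpha> H1" "inv_ahs \<alpha> H2"
  shows "inner_tensor_product \<Z> (assoc_module \<alpha> H1) (assoc_module \<alpha> H2)
    (concrete_module (span_prod (\<M> H1) (\<M> H2))) (*)"
proof -
  let ?E = "concrete_module (\<M> H1)" and ?F = "concrete_module (\<M> H2)"
  let ?P = "pre_tensor ?E ?F" and ?M = "concrete_module (span_prod (\<M> H1) (\<M> H2))"
  define L where "L = lists (\<M> H1 \<times> \<M> H2)"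
  define rep where "rep = (\<lambda>A :: ('f \<times> 'f) list set. SOME u. u \<in> A)"
  \<comment> \<open>\<open>pre_tensor\<close> computes with chosen representatives. U does not
    depend on the choice because a class is a fibre of \<open>tensor_value\<close>.\<close>
  define U where "U = (\<lambda>A. tensor_value (rep A))"
  have cls: "tensor_class ?E ?F u = {v \<in> L. tensor_value v = tensor_value u}" for u
    by (simp add: tensor_class_concrete L_def)
  have "rep (tensor_class ?E ?F u) \<in> tensor_class ?E ?F u" if "u \<in> L" for u
    unfolding rep_def by (rule someI[of _ u]) (simp add: cls that)
  then have rep: "rep (tensor_class ?E ?F u) \<in> L" "U (tensor_class ?E ?F u) = tensor_value u"
    if "u \<in> L" for u using that by (auto simp: cls U_def)
  have carrier: "hcarrier ?P = tensor_class ?E ?F ` L"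
    by (simp add: pre_tensor_def L_def concrete_module_def)
  have repL: "rep A \<in> L" if "A \<in> hcarrier ?P" for A
    using that rep(1) by (auto simp: carrier)
  have ops: "hadd ?P A B = tensor_class ?E ?F (rep A @ rep B)"
    "hinner ?P A B = (U A)\<^sup>\<star> * U B"
    "hsmul ?P A z = tensor_class ?E ?F (map (\<lambda>(x, y). (x, y * z)) (rep A))"
    "hleft ?P z A = tensor_class ?E ?F (map (\<lambda>(x, y). (z * x, y)) (rep A))" for A B z
    by (simp_all add: pre_tensor_def Let_def tensor_form_concrete U_def rep_def
        concrete_module_simps)
  have map_right: "map (\<lambda>(x, y). (x, y * z)) u \<in> L" if "u \<in> L" "z \<in> \<Z>" for u z
    using that intertwined_right by (force simp: in_lists_conv_set L_def)
  have map_left: "map (\<lambda>(x, y). (z * x, y)) u \<in> L" if "u \<in> L" "z \<in> \<Z>" for u z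
    using that intertwined_left[OF assms(1)] by (force simp: in_lists_conv_set L_def)
  \<comment> \<open>The span is the intertwiner set of the composite, which is itself a canonical
    endomorphism.\<close>
  have "hilbert_bimodule \<Z> ?M"
    using endo_compose[OF assms] hilbert_bimodule_intertwined by metis
  moreover have "U A \<in> span_prod (\<M> H1) (\<M> H2)" if "A \<in> hcarrier ?P" for A
  proof -
    have V: "cvec.subspace (span_prod (\<M> H1) (\<M> H2))" by (simp add: span_prod_def)
    have "tensor_value u \<in> span_prod (\<M> H1) (\<M> H2)" if "u \<in> L" for u
      using that unfolding L_def
      by (induction u) (auto intro!: cvec.subspace_0[OF V] cvec.subspace_add[OF V] span_times_span
          cvec.span_base)
    then show ?thesis using repL[OF that] by (simp add: U_def)
  qed
  moreover have "U (hadd ?P A B) = U A + U B" if "A \<in> hcarrier ?P" "B \<in> hcarrier ?P" for A B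
    using repL[OF that(1)] repL[OF that(2)] unfolding ops
    by (subst rep(2)) (auto simp: L_def U_def)
  moreover have "U (hsmul ?P A z) = U A * z" "U (hleft ?P z A) = z * U A"
    if "A \<in> hcarrier ?P" "z \<in> \<Z>" for A z
    using map_right[OF repL[OF that(1)] that(2)] map_left[OF repL[OF that(1)] that(2)]
    unfolding ops
    by (simp_all add: rep(2) tensor_value_map_left tensor_value_map_right) (simp_all add: U_def)
  \<comment> \<open>Density holds exactly: some A satisfies \<open>U A = x\<close>, so completion
    adds nothing.\<close>
  moreover have "\<exists>A\<in>hcarrier ?P. norm (x - U A) < e"
    if x: "x \<in> span_prod (\<M> H1) (\<M> H2)" and e: "e > 0" for x e
  proof -
    obtain u where "u \<in> L" "tensor_value u = x"
      using tensor_value_surj[OF intertwined_subspace x] by (auto simp: L_def)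
    then show ?thesis
      using e rep(2) by (intro bexI[of _ "tensor_class ?E ?F u"]) (auto simp: carrier)
  qed
  ultimately have "hmod_completion \<Z> ?P ?M U"
    unfolding hmod_completion_def hnorm_concrete hminus_concrete
    by (simp add: ops(2)) (simp add: concrete_module_def)
  moreover have "U (tensor_class ?E ?F [(x, y)]) = x * y" if "x \<in> \<M> H1" "y \<in> \<M> H2" for x y
    using that by (subst rep(2)) (auto simp: L_def)
  moreover have "hcarrier ?E = \<M> H1" "hcarrier ?F = \<M> H2" by (simp_all add: concrete_module_def)
  ultimately show ?thesis
    unfolding inner_tensor_product_def assoc_module_eq[OF assms(1)] assoc_module_eq[OF assms(2)]
    by auto
qed

end

theorem proposition4p4:
  fixes \<alpha> :: "'g::{topological_group_add, t2_space} \<Rightarrow> 'f::cstar_algebra \<Rightarrow> 'f"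
  assumes "minimal_hilbert_cstar_system \<alpha>"
  shows
    "subcategory (module_cat \<alpha>) (free_bimodule_cat (fixed_center \<alpha>)) \<and>
     (\<exists>R J. cat_isomorphism (module_cat \<alpha>) (endo_cat \<alpha>) R J \<and>
        (\<forall>H. inv_ahs \<alpha> H \<longrightarrow> R (assoc_module \<alpha> H) = canonical_endo \<alpha> H) \<and>
        (\<forall>H1 H2 T m n \<Psi> \<Phi>.
           inv_ahs \<alpha> H1 \<and> inv_ahs \<alpha> H2 \<and>
           T \<in> Hom (module_cat \<alpha>) (assoc_module \<alpha> H1) (assoc_module \<alpha> H2) \<and>
           module_onb (fixed_center \<alpha>) (assoc_module \<alpha> H2) m \<Psi> \<and>
           module_onb (fixed_center \<alpha>) (assoc_module \<alpha> H1) n \<Phi> \<longrightarrow>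
           J (assoc_module \<alpha> H1) (assoc_module \<alpha> H2) T =
             (\<Sum>j<m. \<Sum>k<n. \<Psi> j * operator_matrix (assoc_module \<alpha> H2) \<Psi> \<Phi> T j k * (\<Phi> k)\<^sup>\<star>))) \<and>
     (\<forall>H1 H2 V W.
        inv_ahs \<alpha> H1 \<and> inv_ahs \<alpha> H2 \<and> V \<in> fixed_algebra \<alpha> \<and> W \<in> fixed_algebra \<alpha> \<and>
        V\<^sup>\<star> * V = 1 \<and> W\<^sup>\<star> * W = 1 \<and> V * V\<^sup>\<star> + W * W\<^sup>\<star> = 1 \<longrightarrow>
        (let \<rho> = (\<lambda>a\<in>fixed_algebra \<alpha>.
               V * canonical_endo \<alpha> H1 a * V\<^sup>\<star> + W * canonical_endo \<alpha> H2 a * W\<^sup>\<star>);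
             M = concrete_module {V * x + W * y |x y.
               x \<in> hcarrier (assoc_module \<alpha> H1) \<and> y \<in> hcarrier (assoc_module \<alpha> H2)}
         in \<rho> \<in> Obj (endo_cat \<alpha>) \<and> M \<in> Obj (module_cat \<alpha>) \<and>
            (\<forall>H. inv_ahs \<alpha> H \<longrightarrow> (canonical_endo \<alpha> H = \<rho> \<longleftrightarrow> assoc_module \<alpha> H = M)))) \<and>
     (\<forall>H1 H2. inv_ahs \<alpha> H1 \<and> inv_ahs \<alpha> H2 \<longrightarrow>
        (let \<rho> = compose (fixed_algebra \<alpha>) (canonical_endo \<alpha> H1) (canonical_endo \<alpha> H2);
             M = concrete_module (span_prod (hcarrier (assoc_module \<alpha> H1))
                                            (hcarrier (assoc_module \<alpha> H2)))
         in \<rho> \<in> Obj (endo_cat \<alpha>) \<and> M \<in> Obj (module_cat \<alpha>) \<and>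
            (\<forall>H. inv_ahs \<alpha> H \<longrightarrow> (canonical_endo \<alpha> H = \<rho> \<longleftrightarrow> assoc_module \<alpha> H = M)) \<and>
            inner_tensor_product (fixed_center \<alpha>) (assoc_module \<alpha> H1) (assoc_module \<alpha> H2) M (*)))"
proof -
  interpret minimal_system \<alpha> by unfold_locales (rule assms)
  show ?thesis
  proof (intro conjI allI impI, goal_cases)
    case 1
    show ?case by (rule subcategory_module_cat)
  next
    case 2
    show ?case
      using cat_isomorphism_intertwiner endo_of_assoc intertwiner_formula by blast
  next
    case (3 H1 H2 V W)
    then obtain K where K: "inv_ahs \<alpha> K"
      "\<rho> K = (\<lambda>a\<in>\<A>. V * \<rho> H1 a * V\<^sup>\<star> + W * \<rho> H2 a * W\<^sup>\<star>)"
      using endo_sum(1) by blast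
    then show ?case
      using 3 object_correspondence[OF K endo_sum(2)] by (simp add: Let_def hcarrier_assoc)
  next
    case (4 H1 H2)
    then obtain K where K: "inv_ahs \<alpha> K" "\<rho> K = compose \<A> (\<rho> H1) (\<rho> H2)"
      using endo_compose(1) by blast
    then show ?case
      using 4 object_correspondence[OF K endo_compose(2)] inner_tensor_product_intertwined
      by (simp add: Let_def hcarrier_assoc)
  qed
qed

end
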